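(* The degree $\deg(\nu)$ of a cycle $\nu$ chosen at random from $\mathscr{C}_n$ with respect to the uniform measure has mean $$ \frac{n}{2}-\frac{1}{n-1} \qquad \text{if } n \geq 3, $$ and variance $$ \frac{n}{12}+\frac{n}{(n-1)^2(n-2)} \qquad \text{if } n \geq 5. $$
   Context: $\mathscr{S}_n$ is the group of all permutations of $\{1,\ldots,n\}$ and $\mathscr{C}_n \subset \mathscr{S}_n$ is the set of all $n$-cycles (so $\#\mathscr{C}_n=(n-1)!$). For $\nu \in \mathscr{S}_n$ the degree is $\deg(\nu) = \#\{ i : \nu(i) > \nu(i+1)\}$, where $i$ ranges over $\{1,\ldots,n\}$ taken modulo $n$, so that $i=n$ is counted exactly when $\nu(n)>\nu(1)$. The mean is $\mu_n = \frac{1}{(n-1)!}\sum_{\nu\in\mathscr{C}_n}\deg(\nu)$ and the variance is $\sigma_n^2=\frac{1}{(n-1)!}\sum_{\nu\in\mathscr{C}_n}(\deg(\nu)-\mu_n)^2$. *)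

theory Defs
  imports Complex_Main "HOL-Combinatorics.Orbits"
begin

text \<open>
  The symmetric group is modelled by the functions \<open>\<nu>\<close> on the naturals with
  \<open>\<nu> permutes {1..n}\<close> (so \<open>\<nu>\<close> is the identity outside \<open>{1..n}\<close>); a permutation is an
  \<open>n\<close>-cycle if \<open>{1..n}\<close> is a single orbit.
\<close>

definition sym_group :: "nat \<Rightarrow> (nat \<Rightarrow> nat) set"
  where "sym_group n = {\<nu>. \<nu> permutes {1..n}}"

definition n_cycles :: "nat \<Rightarrow> (nat \<Rightarrow> nat) set"
  where "n_cycles n = {\<nu> \<in> sym_group n. cyclic_on \<nu> {1..n}}"

text \<open>For \<open>i\<close> in \<open>{1..n}\<close>, \<open>i mod n + 1\<close> is the cyclic successor of \<open>i\<close>: \<open>n\<close> is sent to \<open>1\<close>.\<close>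

definition perm_deg :: "nat \<Rightarrow> (nat \<Rightarrow> nat) \<Rightarrow> nat"
  where "perm_deg n \<nu> = card {i \<in> {1..n}. \<nu> i > \<nu> (i mod n + 1)}"

definition mean_deg :: "nat \<Rightarrow> real"
  where "mean_deg n = 1 / fact (n - 1) * (\<Sum>\<nu>\<in>n_cycles n. real (perm_deg n \<nu>))"

definition var_deg :: "nat \<Rightarrow> real"
  where "var_deg n = 1 / fact (n - 1) * (\<Sum>\<nu>\<in>n_cycles n. (real (perm_deg n \<nu>) - mean_deg n)\<^sup>2)"

end

theory Submission
  imports Defs "HOL-Library.FuncSet" "HOL-Computational_Algebra.Polynomial"
begin

text \<open>
  The mean and the variance are read off from the leading coefficients of one polynomial identity,
  which comes from counting periodic orbits of multiplication by \<open>k\<close> on the circle.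

  The points of period dividing \<open>n\<close> are the fractions \<open>x / (k ^ n - 1)\<close>. If \<open>x\<close> has exact period
  \<open>n\<close>, then numbering the points of its orbit by size turns the map into an \<open>n\<close>-cycle \<open>\<nu>\<close>, the
  number of \<open>x\<close> itself is a marked element, and the leading base-\<open>k\<close> digits of the orbit points
  form a weakly increasing labelling of \<open>{1..n}\<close> that increases strictly at the descents of
  \<open>\<nu>\<close>. Conversely such a triple spells out a base-\<open>k\<close> word of length \<open>n\<close>. Both passages are
  injective (\<open>card_period_points_le\<close>, \<open>card_labelled_cycles_le\<close>), and all but
  \<open>O(k ^ (n div 2))\<close> of the \<open>k ^ n - 1\<close> points have exact period \<open>n\<close>. Hence the number of labelled
  marked cycles is \<open>k ^ n + O(k ^ (n div 2))\<close>.

  On the other hand a stars-and-bars count makes this number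
  \<open>n * (\<Sum>\<nu>. (k + n - 1 - des \<nu>) choose n)\<close>, where \<open>des\<close> counts the descents at \<open>1, ..., n - 1\<close>
  only. The degree differs from \<open>des\<close> by the indicator of \<open>\<nu> n > \<nu> 1\<close>. Conjugation by the
  rotation \<open>i \<mapsto> i + 1\<close> preserves the degree, and among the \<open>n\<close> rotated copies of \<open>\<nu>\<close> exactly
  \<open>deg \<nu> - 1\<close> satisfy \<open>\<nu> n > \<nu> 1\<close>; this is the fact that a circle map of degree \<open>d\<close> has
  \<open>d - 1\<close> fixed points. Averaging over rotations therefore turns the count into
  \<open>(k - 1) * (\<Sum>\<nu>. (n - 1 + k - deg \<nu>) choose (n - 1))\<close>.

  So \<open>(k - 1) * (\<Sum>\<nu>. (k - deg \<nu> + 1) * ... * (k - deg \<nu> + n - 1))\<close> is a polynomial in \<open>k\<close> whose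
  coefficients above degree \<open>n div 2\<close> are those of \<open>(n - 1)! * k ^ n\<close>
  (\<open>coeff_deg_poly_times_linear\<close>). Its coefficients of \<open>k ^ n\<close>, \<open>k ^ (n - 1)\<close> and
  \<open>k ^ (n - 2)\<close> involve the number of cycles, the sum of the degrees and the sum of their squares.
  The conditions \<open>n - 1 > n div 2\<close> and \<open>n - 2 > n div 2\<close> are the hypotheses \<open>n \<ge> 3\<close> and
  \<open>n \<ge> 5\<close>.
\<close>

section \<open>Cycles, their degree and conjugation by the rotation\<close>

lemma n_cyclesD:
  assumes "\<nu> \<in> n_cycles n"
  shows "\<nu> permutes {1..n}" "cyclic_on \<nu> {1..n}"
  using assms by (auto simp: n_cycles_def sym_group_def)

lemma finite_n_cycles: "finite (n_cycles n)"
  by (rule finite_subset[OF _ finite_permutations[of "{1..n}"]]) (auto simp: n_cycles_def sym_group_def)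

lemma n_cycles_in_range: "\<nu> \<in> n_cycles n \<Longrightarrow> i \<in> {1..n} \<Longrightarrow> \<nu> i \<in> {1..n}"
  by (metis n_cyclesD(1) permutes_in_image)

lemma n_cycles_inj: "\<nu> \<in> n_cycles n \<Longrightarrow> inj \<nu>"
  by (metis n_cyclesD(1) permutes_inj)

lemma n_cycles_no_fixpoint:
  assumes "\<nu> \<in> n_cycles n" "i \<in> {1..n}" "n \<ge> 2"
  shows "\<nu> i \<noteq> i"
  using eq_on_cyclic_on_iff1[OF n_cyclesD(2)[OF assms(1)] assms(2)] assms(3) by auto

text \<open>
  Iterating a cycle from any start visits every element once and then returns; this parametrizes
  \<open>{1..n}\<close> by time.
\<close>
lemma n_cycles_traversal:
  assumes "\<nu> \<in> n_cycles n" "s \<in> {1..n}"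
  shows "bij_betw (\<lambda>m. (\<nu> ^^ m) s) {..<n} {1..n}" and "(\<nu> ^^ n) s = s"
proof -
  have o: "orbit \<nu> s = {1..n}"
    using orbit_cyclic_eq3[OF n_cyclesD(2)[OF assms(1)] assms(2)] .
  then have s: "s \<in> orbit \<nu> s" using assms(2) by simp
  have im: "(\<lambda>m. (\<nu> ^^ m) s) ` {0..<funpow_dist1 \<nu> s s} = {1..n}"
    using orbit_conv_funpow_dist1[OF s] o by simp
  have inj: "inj_on (\<lambda>m. (\<nu> ^^ m) s) {0..<funpow_dist1 \<nu> s s}"
    using inj_on_funpow_dist1[OF s] .
  have d: "funpow_dist1 \<nu> s s = n"
    using card_image[OF inj] im by simp
  show "bij_betw (\<lambda>m. (\<nu> ^^ m) s) {..<n} {1..n}"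
    using im inj unfolding d by (simp add: bij_betw_def atLeast0LessThan)
  show "(\<nu> ^^ n) s = s"
    using funpow_dist1_prop[OF s] unfolding d .
qed

definition cyc_succ :: "nat \<Rightarrow> nat \<Rightarrow> nat"
  where "cyc_succ n i = (if i \<in> {1..n} then i mod n + 1 else i)"

lemma cyc_succ_in: "i \<in> {1..n} \<Longrightarrow> cyc_succ n i \<in> {1..n}"
  by (auto simp: cyc_succ_def Suc_le_eq)

lemma cyc_succ_eq: "i \<in> {1..n} \<Longrightarrow> cyc_succ n i = (if i = n then 1 else Suc i)"
  by (auto simp: cyc_succ_def)

lemma cyc_succ_permutes: "cyc_succ n permutes {1..n}"
proof (rule bij_imp_permutes)
  have "inj_on (cyc_succ n) {1..n}"
  proof (rule inj_onI)
    fix i j assume "i \<in> {1..n}" "j \<in> {1..n}" "cyc_succ n i = cyc_succ n j"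
    then have "(if i = n then 1 else Suc i) = (if j = n then 1 else Suc j)" "i \<ge> 1" "j \<ge> 1"
      by (simp_all only: cyc_succ_eq) auto
    then show "i = j" by (cases "i = n"; cases "j = n") simp_all
  qed
  moreover have "cyc_succ n ` {1..n} \<subseteq> {1..n}" using cyc_succ_in by blast
  ultimately show "bij_betw (cyc_succ n) {1..n} {1..n}"
    by (simp add: bij_betw_def endo_inj_surj)
qed (auto simp: cyc_succ_def)

lemma sum_cyc_succ: "(\<Sum>i\<in>{1..n}. f (cyc_succ n i)) = (\<Sum>i\<in>{1..n}. f i)"
  by (rule sum.reindex_bij_betw[OF permutes_imp_bij[OF cyc_succ_permutes]])

lemma cyc_succ_mod:
  assumes "i \<in> {1..n}"
  shows "int (cyc_succ n i) mod int n = (int i + 1) mod int n"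
  using assms by (auto simp: cyc_succ_eq add.commute)

lemma perm_deg_cyc_succ: "perm_deg n \<nu> = card {i \<in> {1..n}. \<nu> i > \<nu> (cyc_succ n i)}"
  unfolding perm_deg_def by (rule arg_cong[where f = card]) (auto simp: cyc_succ_def)

text \<open>
  The degree is the winding number of the closed walk \<open>\<nu> 1, \<nu> 2, ..., \<nu> n, \<nu> 1\<close> on the circle
  of \<open>n\<close> points: going always upwards, a step makes the excess \<open>n\<close> over the plain difference
  exactly when it is a descent, and the plain differences cancel. This form depends only on
  residues, so it is visibly invariant under rotation.
\<close>
lemma perm_deg_sum_differences:
  assumes "\<nu> \<in> n_cycles n"
  shows "int n * int (perm_deg n \<nu>) = (\<Sum>i\<in>{1..n}. (int (\<nu> (cyc_succ n i)) - int (\<nu> i)) mod int n)"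
proof -
  have "(int (\<nu> (cyc_succ n i)) - int (\<nu> i)) mod int n
      = int (\<nu> (cyc_succ n i)) - int (\<nu> i) + int n * (if \<nu> i > \<nu> (cyc_succ n i) then 1 else 0)"
    if i: "i \<in> {1..n}" for i
  proof -
    have r: "\<nu> i \<in> {1..n}" "\<nu> (cyc_succ n i) \<in> {1..n}"
      using n_cycles_in_range[OF assms] i cyc_succ_in by blast+
    show ?thesis
    proof (cases "\<nu> i > \<nu> (cyc_succ n i)")
      case True
      have "(int (\<nu> (cyc_succ n i)) - int (\<nu> i)) mod int n
          = (int (\<nu> (cyc_succ n i)) - int (\<nu> i) + int n) mod int n" by simp
      also have "\<dots> = int (\<nu> (cyc_succ n i)) - int (\<nu> i) + int n"
        by (rule mod_pos_pos_trivial) (use r True in auto)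
      finally show ?thesis using True by simp
    next
      case False
      then show ?thesis using r by (auto intro!: mod_pos_pos_trivial)
    qed
  qed
  then have "(\<Sum>i\<in>{1..n}. (int (\<nu> (cyc_succ n i)) - int (\<nu> i)) mod int n)
     = (\<Sum>i\<in>{1..n}. int (\<nu> (cyc_succ n i))) - (\<Sum>i\<in>{1..n}. int (\<nu> i))
       + int n * (\<Sum>i\<in>{1..n}. if \<nu> i > \<nu> (cyc_succ n i) then 1 else 0)"
    by (simp add: sum.distrib sum_subtractf sum_distrib_left)
  also have "(\<Sum>i\<in>{1..n}. if \<nu> i > \<nu> (cyc_succ n i) then 1 else 0) = int (perm_deg n \<nu>)"
    by (simp add: perm_deg_cyc_succ sum.If_cases Int_def)
  finally show ?thesis using sum_cyc_succ[of "\<lambda>i. int (\<nu> i)" n] by simp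
qed

text \<open>
  How far \<open>\<nu>\<close> moves \<open>i\<close> forward around the circle. It is the quantity to look at because it is
  unchanged by rotation (with \<open>i\<close> rotated along) and equals \<open>\<nu> n\<close> at \<open>i = n\<close>.
\<close>
definition displacement :: "nat \<Rightarrow> (nat \<Rightarrow> nat) \<Rightarrow> nat \<Rightarrow> int"
  where "displacement n \<nu> i = (int (\<nu> i) - int i) mod int n"

lemma displacement_bounds:
  assumes "\<nu> \<in> n_cycles n" "i \<in> {1..n}" "n \<ge> 2"
  shows "1 \<le> displacement n \<nu> i" "displacement n \<nu> i < int n"
proof -
  have r: "\<nu> i \<in> {1..n}" "\<nu> i \<noteq> i"
    using n_cycles_in_range[OF assms(1,2)] n_cycles_no_fixpoint[OF assms] by auto
  show "displacement n \<nu> i < int n" using assms by (simp add: displacement_def)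
  have "\<not> int n dvd int (\<nu> i) - int i"
    using r assms(2) zdvd_not_zless[of "\<bar>int (\<nu> i) - int i\<bar>" "int n"]
    by (auto simp: abs_less_iff)
  then have "displacement n \<nu> i \<noteq> 0" by (simp add: displacement_def dvd_eq_mod_eq_0)
  moreover have "displacement n \<nu> i \<ge> 0" using assms by (simp add: displacement_def)
  ultimately show "1 \<le> displacement n \<nu> i" by simp
qed

text \<open>
  The discrete form of the statement that a circle map of degree \<open>d\<close> has \<open>d - 1\<close> fixed points.
  The step from \<open>\<nu> i\<close> to the next value is one more than the change of the displacement, up to an
  \<open>n\<close> exactly at the descents of the displacement; summing around the circle, the
  changes cancel and the \<open>n\<close> ones add up to a single turn.
\<close>
lemma card_displacement_descents:
  assumes "\<nu> \<in> n_cycles n" "n \<ge> 2"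
  shows "int (card {i \<in> {1..n}. displacement n \<nu> i > displacement n \<nu> (cyc_succ n i)})
       = int (perm_deg n \<nu>) - 1"
proof -
  let ?r = "displacement n \<nu>" and ?s = "cyc_succ n"
  have "(int (\<nu> (?s i)) - int (\<nu> i)) mod int n
      = ?r (?s i) - ?r i + 1 + int n * (if ?r i > ?r (?s i) then 1 else 0)"
    if i: "i \<in> {1..n}" for i
  proof -
    have si: "?s i \<in> {1..n}" using cyc_succ_in[OF i] .
    have cong: "(int (\<nu> (?s i)) - int (\<nu> i)) mod int n = (?r (?s i) - ?r i + 1) mod int n"
    proof -
      have "(?r (?s i) - ?r i + 1) mod int n
          = ((int (\<nu> (?s i)) - int (?s i)) - (int (\<nu> i) - int i) + 1) mod int n"
        unfolding displacement_def by (intro mod_add_cong mod_diff_cong mod_mod_trivial refl)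
      also have "\<dots> = ((int (\<nu> (?s i)) - int (\<nu> i) + int i + 1) - int (?s i) mod int n) mod int n"
        unfolding mod_diff_right_eq by (rule arg_cong[where f = "\<lambda>x. x mod int n"]) simp
      also have "\<dots> = ((int (\<nu> (?s i)) - int (\<nu> i) + int i + 1) - (int i + 1)) mod int n"
        unfolding cyc_succ_mod[OF i] by (rule mod_diff_right_eq)
      finally show ?thesis by simp
    qed
    have ne: "(int (\<nu> (?s i)) - int (\<nu> i)) mod int n \<noteq> 0"
    proof
      assume "(int (\<nu> (?s i)) - int (\<nu> i)) mod int n = 0"
      then have "int n dvd int (\<nu> (?s i)) - int (\<nu> i)" by auto
      moreover have "\<nu> (?s i) \<in> {1..n}" "\<nu> i \<in> {1..n}"
        using n_cycles_in_range[OF assms(1)] i si by auto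
      ultimately have "\<nu> (?s i) = \<nu> i"
        using zdvd_not_zless[of "\<bar>int (\<nu> (?s i)) - int (\<nu> i)\<bar>" "int n"]
        by (auto simp: abs_less_iff)
      then have "?s i = i" using n_cycles_inj[OF assms(1)] by (simp add: inj_eq)
      then show False using i assms(2) by (auto simp: cyc_succ_eq split: if_splits)
    qed
    note b = displacement_bounds[OF assms(1) i assms(2)] displacement_bounds[OF assms(1) si assms(2)]
    show ?thesis
    proof (cases "?r i > ?r (?s i)")
      case True
      have "?r (?s i) - ?r i + 1 \<noteq> 0" using ne cong by auto
      then have "(?r (?s i) - ?r i + 1 + int n) mod int n = ?r (?s i) - ?r i + 1 + int n"
        using True b by (intro mod_pos_pos_trivial) auto
      then show ?thesis using True cong by simp
    next
      case False
      then have "(?r (?s i) - ?r i + 1) mod int n = ?r (?s i) - ?r i + 1"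
        using b by (intro mod_pos_pos_trivial) auto
      then show ?thesis using False cong by simp
    qed
  qed
  then have "int n * int (perm_deg n \<nu>)
     = (\<Sum>i\<in>{1..n}. ?r (?s i)) - (\<Sum>i\<in>{1..n}. ?r i) + int n
       + int n * (\<Sum>i\<in>{1..n}. if ?r i > ?r (?s i) then 1 else 0)"
    by (simp add: perm_deg_sum_differences[OF assms(1)] sum.distrib sum_subtractf sum_distrib_left)
  also have "(\<Sum>i\<in>{1..n}. if ?r i > ?r (?s i) then 1 else 0)
      = int (card {i \<in> {1..n}. ?r i > ?r (?s i)})"
    by (simp add: sum.If_cases Int_def)
  finally have "int n * int (perm_deg n \<nu>) = int n * (1 + int (card {i \<in> {1..n}. ?r i > ?r (?s i)}))"
    using sum_cyc_succ[of ?r n] by (simp add: algebra_simps)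
  then show ?thesis using assms(2) by simp
qed

definition rotate_perm :: "nat \<Rightarrow> (nat \<Rightarrow> nat) \<Rightarrow> nat \<Rightarrow> nat"
  where "rotate_perm n \<nu> = cyc_succ n \<circ> \<nu> \<circ> inv (cyc_succ n)"

lemma rotate_perm_cyc_succ: "rotate_perm n \<nu> (cyc_succ n i) = cyc_succ n (\<nu> i)"
  using permutes_inj[OF cyc_succ_permutes] by (simp add: rotate_perm_def)

lemma bij_betw_rotate_perm: "bij_betw (rotate_perm n) (n_cycles n) (n_cycles n)"
proof -
  note p = cyc_succ_permutes[of n]
  have "rotate_perm n \<nu> \<in> n_cycles n" if \<nu>: "\<nu> \<in> n_cycles n" for \<nu>
  proof -
    have "rotate_perm n \<nu> permutes {1..n}"
      unfolding rotate_perm_def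
      by (intro permutes_compose permutes_inv p n_cyclesD(1)[OF \<nu>])
    moreover have "cyclic_on (rotate_perm n \<nu>) (cyc_succ n ` {1..n})"
      by (rule cyclic_on_image[OF n_cyclesD(2)[OF \<nu>]]) (rule rotate_perm_cyc_succ)
    ultimately show ?thesis
      unfolding n_cycles_def sym_group_def permutes_image[OF p] by blast
  qed
  moreover have "inj_on (rotate_perm n) (n_cycles n)"
  proof (rule inj_onI, rule ext)
    fix \<nu> \<nu>' i assume "rotate_perm n \<nu> = rotate_perm n \<nu>'"
    then have "cyc_succ n (\<nu> i) = cyc_succ n (\<nu>' i)"
      by (metis rotate_perm_cyc_succ)
    then show "\<nu> i = \<nu>' i" using permutes_inj[OF p] by (simp add: inj_eq)
  qed
  ultimately show ?thesis
    by (simp add: bij_betw_def endo_inj_surj finite_n_cycles image_subset_iff)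
qed

lemma cyc_succ_difference:
  assumes "i \<in> {1..n}" "j \<in> {1..n}"
  shows "(int (cyc_succ n i) - int (cyc_succ n j)) mod int n = (int i - int j) mod int n"
  using mod_diff_cong[OF cyc_succ_mod[OF assms(1)] cyc_succ_mod[OF assms(2)]] by simp

lemma perm_deg_rotate_perm:
  assumes "\<nu> \<in> n_cycles n" "n \<ge> 2"
  shows "perm_deg n (rotate_perm n \<nu>) = perm_deg n \<nu>"
proof -
  let ?s = "cyc_succ n" and ?\<rho> = "rotate_perm n \<nu>"
  have R: "?\<rho> \<in> n_cycles n" using bij_betw_rotate_perm assms(1) by (metis bij_betwE)
  have "int n * int (perm_deg n ?\<rho>) = (\<Sum>i\<in>{1..n}. (int (?\<rho> (?s (?s i))) - int (?\<rho> (?s i))) mod int n)"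
    unfolding perm_deg_sum_differences[OF R]
    by (rule sum_cyc_succ[symmetric, where f = "\<lambda>i. (int (?\<rho> (?s i)) - int (?\<rho> i)) mod int n"])
  also have "\<dots> = (\<Sum>i\<in>{1..n}. (int (\<nu> (?s i)) - int (\<nu> i)) mod int n)"
    unfolding rotate_perm_cyc_succ
    by (intro sum.cong refl cyc_succ_difference n_cycles_in_range[OF assms(1)] cyc_succ_in)
  also have "\<dots> = int n * int (perm_deg n \<nu>)"
    by (rule perm_deg_sum_differences[OF assms(1), symmetric])
  finally show ?thesis using assms(2) by simp
qed

lemma displacement_rotate_perm:
  assumes "\<nu> \<in> n_cycles n" "i \<in> {1..n}"
  shows "displacement n (rotate_perm n \<nu>) (cyc_succ n i) = displacement n \<nu> i"
  unfolding displacement_def rotate_perm_cyc_succ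
  by (intro cyc_succ_difference n_cycles_in_range[OF assms(1)] assms(2))

text \<open>
  The displacements at \<open>n\<close> and \<open>1\<close> are \<open>\<nu> n\<close> and \<open>\<nu> 1 - 1\<close>, and \<open>\<nu> n \<noteq> \<nu> 1\<close>.
\<close>
lemma displacement_descent_last:
  assumes "\<nu> \<in> n_cycles n" "n \<ge> 2"
  shows "displacement n \<nu> n > displacement n \<nu> (cyc_succ n n) \<longleftrightarrow> \<nu> n > \<nu> 1"
proof -
  have r: "\<nu> n \<in> {1..n}" "\<nu> 1 \<in> {1..n}" "\<nu> n \<noteq> n" "\<nu> 1 \<noteq> 1"
    using n_cycles_in_range[OF assms(1)] n_cycles_no_fixpoint[OF assms(1)] assms(2) by auto
  have "displacement n \<nu> n = int (\<nu> n)"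
    using r by (simp add: displacement_def)
  moreover have "displacement n \<nu> 1 = int (\<nu> 1) - 1"
    using r by (auto simp: displacement_def intro!: mod_pos_pos_trivial)
  moreover have "cyc_succ n n = 1" using assms(2) by (simp add: cyc_succ_def)
  moreover have "\<nu> n \<noteq> \<nu> 1" using n_cycles_inj[OF assms(1)] assms(2) by (auto simp: inj_eq)
  ultimately show ?thesis by auto
qed

text \<open>
  Averaged over rotations, the indicator of a descent from \<open>n\<close> to \<open>1\<close> may be replaced by
  \<open>(deg \<nu> - 1) / n\<close>: it is the indicator of a displacement descent at \<open>n\<close>, rotation moves this
  to a displacement descent at any other place without changing the degree, and the
  number of all of these places is \<open>deg \<nu> - 1\<close>.
\<close>
lemma sum_last_descent:
  fixes f :: "nat \<Rightarrow> real"
  assumes "n \<ge> 2"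
  shows "real n * (\<Sum>\<nu>\<in>n_cycles n. (if \<nu> n > \<nu> 1 then f (perm_deg n \<nu>) else 0))
       = (\<Sum>\<nu>\<in>n_cycles n. (real (perm_deg n \<nu>) - 1) * f (perm_deg n \<nu>))"
proof -
  let ?s = "cyc_succ n" and ?r = "displacement n"
  \<comment> \<open>The sum over displacement descents at place \<open>i\<close>; rotation shows that it does not depend on \<open>i\<close>.\<close>
  define U where "U i = (\<Sum>\<nu>\<in>n_cycles n. if ?r \<nu> i > ?r \<nu> (?s i) then f (perm_deg n \<nu>) else 0)" for i
  have U_step: "U (?s i) = U i" if i: "i \<in> {1..n}" for i
  proof -
    have "U (?s i) = (\<Sum>\<nu>\<in>n_cycles n. if ?r (rotate_perm n \<nu>) (?s i) > ?r (rotate_perm n \<nu>) (?s (?s i))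
            then f (perm_deg n (rotate_perm n \<nu>)) else 0)"
      unfolding U_def by (rule sum.reindex_bij_betw[OF bij_betw_rotate_perm, symmetric])
    also have "\<dots> = U i"
      unfolding U_def
      by (intro sum.cong refl)
         (simp add: perm_deg_rotate_perm assms
           displacement_rotate_perm[OF _ i] displacement_rotate_perm[OF _ cyc_succ_in[OF i]])
    finally show ?thesis .
  qed
  have U_const: "U i = U n" if "i \<in> {1..n}" for i
  proof -
    have "i \<le> n" using that by simp
    then show ?thesis
    proof (induction rule: inc_induct)
      case (step m)
      then have "m \<in> {1..n}" "m \<noteq> n" using that by auto
      then have "U (Suc m) = U m" using U_step[of m] by (simp only: cyc_succ_eq if_False)
      then show ?case using step.IH by simp
    qed simp
  qed
  have "(\<Sum>\<nu>\<in>n_cycles n. (if \<nu> n > \<nu> 1 then f (perm_deg n \<nu>) else 0)) = U n"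
    unfolding U_def by (intro sum.cong refl) (simp only: displacement_descent_last[OF _ assms])
  moreover have "(\<Sum>i\<in>{1..n}. U i) = (\<Sum>i\<in>{1..n}. U n)"
    by (intro sum.cong refl U_const)
  ultimately have "real n * (\<Sum>\<nu>\<in>n_cycles n. (if \<nu> n > \<nu> 1 then f (perm_deg n \<nu>) else 0)) = (\<Sum>i\<in>{1..n}. U i)"
    by simp
  also have "\<dots> = (\<Sum>\<nu>\<in>n_cycles n. \<Sum>i\<in>{1..n}. if ?r \<nu> i > ?r \<nu> (?s i) then f (perm_deg n \<nu>) else 0)"
    unfolding U_def by (rule sum.swap)
  also have "\<dots> = (\<Sum>\<nu>\<in>n_cycles n. (real (perm_deg n \<nu>) - 1) * f (perm_deg n \<nu>))"
  proof (intro sum.cong refl)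
    fix \<nu> assume \<nu>: "\<nu> \<in> n_cycles n"
    have "(\<Sum>i\<in>{1..n}. if ?r \<nu> i > ?r \<nu> (?s i) then f (perm_deg n \<nu>) else 0)
        = real (card {i \<in> {1..n}. ?r \<nu> i > ?r \<nu> (?s i)}) * f (perm_deg n \<nu>)"
      by (simp add: sum.If_cases Int_def)
    also have "real (card {i \<in> {1..n}. ?r \<nu> i > ?r \<nu> (?s i)}) = real (perm_deg n \<nu>) - 1"
      using card_displacement_descents[OF \<nu> assms] by linarith
    finally show "(\<Sum>i\<in>{1..n}. if ?r \<nu> i > ?r \<nu> (?s i) then f (perm_deg n \<nu>) else 0)
      = (real (perm_deg n \<nu>) - 1) * f (perm_deg n \<nu>)" .
  qed
  finally show ?thesis .
qed

section \<open>Labellings that increase at descents\<close>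

definition step_sequences :: "nat \<Rightarrow> nat \<Rightarrow> nat set \<Rightarrow> (nat \<Rightarrow> nat) set"
  where "step_sequences n k S =
    {a \<in> {1..n} \<rightarrow>\<^sub>E {..<k}. \<forall>i\<in>{1..<n}. a i \<le> a (Suc i) \<and> (i \<in> S \<longrightarrow> a i < a (Suc i))}"

lemma finite_step_sequences: "finite (step_sequences n k S)"
  by (rule finite_subset[of _ "{1..n} \<rightarrow>\<^sub>E {..<k}"]) (auto simp: step_sequences_def intro: finite_PiE)

lemma step_sequences_step:
  assumes "a \<in> step_sequences n k S" "1 \<le> i" "i < n"
  shows "a i \<le> a (Suc i)" "i \<in> S \<Longrightarrow> a i < a (Suc i)"
  using assms by (auto simp: step_sequences_def)

lemma step_sequences_mono:
  assumes "a \<in> step_sequences n k S" "1 \<le> i" "i \<le> j" "j \<le> n"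
  shows "a i \<le> a j"
  using assms(3,4)
proof (induction j rule: dec_induct)
  case (step m)
  then show ?case using step_sequences_step(1)[OF assms(1), of m] assms(2) by auto
qed simp

text \<open>
  If the last label is not \<open>k\<close> then, by monotonicity, no label is. If it is \<open>k\<close>, it can be cut
  off, and \<open>k\<close> remains available to the other labels unless the step before it is a forced one.
\<close>
lemma step_sequences_Suc:
  assumes "n \<ge> 1"
  shows "step_sequences (Suc n) (Suc k) S = step_sequences (Suc n) k S \<union>
    (\<lambda>b. b(Suc n := k)) ` step_sequences n (if n \<in> S then k else Suc k) S" (is "?L = ?A \<union> ?f ` ?B")
proof (intro equalityI subsetI)
  fix a assume a: "a \<in> ?L"
  have val: "a i < Suc k" if "i \<in> {1..Suc n}" for i
    using a that by (auto simp: step_sequences_def)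
  have ext: "a i = undefined" if "i \<notin> {1..Suc n}" for i
    using a that by (auto simp: step_sequences_def PiE_def extensional_def)
  have mono: "a i \<le> a j" if "1 \<le> i" "i \<le> j" "j \<le> Suc n" for i j
    by (rule step_sequences_mono[OF a that])
  have steps: "\<forall>i\<in>{1..<Suc n}. a i \<le> a (Suc i) \<and> (i \<in> S \<longrightarrow> a i < a (Suc i))"
    using a by (simp add: step_sequences_def)
  show "a \<in> ?A \<union> ?f ` ?B"
  proof (cases "a (Suc n) = k")
    case False
    then have "a (Suc n) < k" using val[of "Suc n"] by simp
    then have "a i < k" if "i \<in> {1..Suc n}" for i
      using mono[of i "Suc n"] that by simp
    then have "a \<in> ?A" using steps ext by (auto simp: step_sequences_def PiE_def extensional_def)
    then show ?thesis ..
  next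
    case True
    let ?b = "a(Suc n := undefined)"
    have "a n < (if n \<in> S then k else Suc k)"
      using steps assms True val[of n] by auto
    then have "a i < (if n \<in> S then k else Suc k)" if "i \<in> {1..n}" for i
      using mono[of i n] that by (meson atLeastAtMost_iff le_SucI le_less_trans order_refl)
    then have "?b \<in> {1..n} \<rightarrow>\<^sub>E {..<(if n \<in> S then k else Suc k)}"
      using ext by (auto simp: PiE_def extensional_def)
    moreover have "\<forall>i\<in>{1..<n}. ?b i \<le> ?b (Suc i) \<and> (i \<in> S \<longrightarrow> ?b i < ?b (Suc i))"
      using steps by auto
    ultimately have "?b \<in> ?B" unfolding step_sequences_def by blast
    moreover have "a = ?f ?b" using True by auto
    ultimately show ?thesis by blast
  qed
next
  fix a assume "a \<in> ?A \<union> ?f ` ?B"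
  then show "a \<in> ?L"
  proof
    assume "a \<in> ?A"
    then show ?thesis by (auto simp: step_sequences_def PiE_def Pi_def less_Suc_eq)
  next
    assume "a \<in> ?f ` ?B"
    then obtain b where b: "b \<in> ?B" "a = b(Suc n := k)" by blast
    have val: "b i < (if n \<in> S then k else Suc k)" if "i \<in> {1..n}" for i
      using b(1) that by (fastforce simp: step_sequences_def)
    have ext: "b i = undefined" if "i \<notin> {1..n}" for i
      using b(1) that by (auto simp: step_sequences_def PiE_def extensional_def)
    have "a i < Suc k" if "i \<in> {1..Suc n}" for i
    proof (cases "i = Suc n")
      case False
      then show ?thesis using val[of i] that b(2) by (auto split: if_splits)
    qed (simp add: b(2))
    moreover have "a i \<le> a (Suc i) \<and> (i \<in> S \<longrightarrow> a i < a (Suc i))" if "i \<in> {1..<Suc n}" for i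
    proof (cases "i = n")
      case True
      then show ?thesis using val[of n] assms b(2) by (auto split: if_splits)
    next
      case False
      then show ?thesis using step_sequences_step[OF b(1), of i] that b(2) by auto
    qed
    ultimately show ?thesis
      using ext b(2) by (auto simp: step_sequences_def PiE_def extensional_def)
  qed
qed

text \<open>
  Stars and bars: adding \<open>i - 1\<close> minus the number of earlier elements of \<open>S\<close> to the \<open>i\<close>-th label
  gives all strictly increasing sequences in a set of \<open>k + n - 1 - card (S \<inter> {1..<n})\<close> elements.
  The proof uses that the recursion of \<open>step_sequences_Suc\<close> is Pascal's rule.
\<close>
lemma card_step_sequences:
  assumes "n \<ge> 1"
  shows "card (step_sequences n k S) = (k + n - 1 - card (S \<inter> {1..<n})) choose n"
  using assms
proof (induction n arbitrary: k rule: dec_induct)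
  case base
  have "step_sequences 1 k S = {1..1} \<rightarrow>\<^sub>E {..<k}" by (auto simp: step_sequences_def)
  then show ?case by (simp add: card_PiE)
next
  case (step n)
  define c where "c = card (S \<inter> {1..<n})"
  define e where "e = (if n \<in> S then 1 else 0 :: nat)"
  have "S \<inter> {1..<Suc n} = (if n \<in> S then insert n (S \<inter> {1..<n}) else S \<inter> {1..<n})"
    using step.hyps by (auto simp: less_Suc_eq)
  then have c: "card (S \<inter> {1..<Suc n}) = c + e" by (simp add: c_def e_def)
  have "c \<le> card {1..<n}" unfolding c_def by (rule card_mono) auto
  then have cn: "c + 1 \<le> n" using step.hyps by simp
  then have cn': "c + e \<le> n" by (simp add: e_def)
  have "card (step_sequences (Suc n) k S) = (k + n - (c + e)) choose (Suc n)"
  proof (induction k)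
    case 0
    have "step_sequences (Suc n) 0 S = {}"
      by (auto simp: step_sequences_def PiE_eq_empty_iff)
    moreover have "n - (c + e) < Suc n" by simp
    ultimately show ?case by (simp add: binomial_eq_0)
  next
    case (Suc k)
    let ?k = "if n \<in> S then k else Suc k"
    have "inj_on (\<lambda>b. b(Suc n := k)) (step_sequences n ?k S)"
    proof (rule inj_onI)
      fix b b' assume *: "b \<in> step_sequences n ?k S" "b' \<in> step_sequences n ?k S"
        "b(Suc n := k) = b'(Suc n := k)"
      then have "b (Suc n) = b' (Suc n)"
        by (auto simp: step_sequences_def PiE_def extensional_def)
      then show "b = b'" using *(3) by (metis fun_upd_triv fun_upd_upd)
    qed
    then have "card ((\<lambda>b. b(Suc n := k)) ` step_sequences n ?k S) = (?k + n - 1 - c) choose n"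
      by (simp add: card_image step.IH c_def)
    also have "?k + n - 1 - c = k + n - (c + e)"
      using cn by (auto simp: e_def)
    finally have top: "card ((\<lambda>b. b(Suc n := k)) ` step_sequences n ?k S) = (k + n - (c + e)) choose n" .
    have "step_sequences (Suc n) k S \<inter> (\<lambda>b. b(Suc n := k)) ` step_sequences n ?k S = {}"
    proof -
      have "a (Suc n) < k" if "a \<in> step_sequences (Suc n) k S" for a
        using that by (fastforce simp: step_sequences_def)
      then show ?thesis by fastforce
    qed
    then have "card (step_sequences (Suc n) (Suc k) S) =
        ((k + n - (c + e)) choose (Suc n)) + ((k + n - (c + e)) choose n)"
      unfolding step_sequences_Suc[OF step.hyps(1)]
      by (subst card_Un_disjoint) (simp_all add: finite_step_sequences top Suc.IH del: image_Int)
    also have "\<dots> = Suc (k + n - (c + e)) choose Suc n" by simp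
    also have "Suc (k + n - (c + e)) = Suc k + n - (c + e)" using cn' by simp
    finally show ?case .
  qed
  then show ?case using c by simp
qed

definition descents :: "(nat \<Rightarrow> nat) \<Rightarrow> nat set"
  where "descents \<nu> = {i. \<nu> i > \<nu> (Suc i)}"

text \<open>
  On a run of equal labels there is no descent, so \<open>\<nu>\<close> is increasing there. In other words the
  labels decide the order of two elements or pass the question on to their images, as the digits of
  two numbers do.
\<close>
lemma step_sequences_descents_less:
  assumes "a \<in> step_sequences n k (descents \<nu>)" "inj \<nu>" "1 \<le> i" "i < j" "j \<le> n" "a i = a j"
  shows "\<nu> i < \<nu> j"
proof -
  have "Suc i \<le> j" using assms(4) by simp
  then show ?thesis using assms(5,6)
  proof (induction j rule: dec_induct)
    case base
    then have "i \<notin> descents \<nu>" using step_sequences_step(2)[OF assms(1,3)] by auto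
    then show ?case using injD[OF assms(2), of i "Suc i"] by (fastforce simp: descents_def)
  next
    case (step m)
    have "a i \<le> a m" "a m \<le> a (Suc m)"
      using step_sequences_mono[OF assms(1), of i m] step_sequences_step(1)[OF assms(1), of m]
        step assms(3) by auto
    then have eq: "a i = a m" "a m = a (Suc m)" using step.prems by auto
    then have "m \<notin> descents \<nu>" using step_sequences_step(2)[OF assms(1), of m] step assms(3) by auto
    then have "\<nu> m < \<nu> (Suc m)" using injD[OF assms(2), of m "Suc m"] by (fastforce simp: descents_def)
    moreover have "\<nu> i < \<nu> m" using step eq by simp
    ultimately show ?case by simp
  qed
qed

text \<open>
  The combinatorial counterpart of the points of exact period \<open>n\<close>: the second component is the
  number of the point within its orbit, and the labels are the digits.
\<close>
definition labelled_cycles :: "nat \<Rightarrow> nat \<Rightarrow> ((nat \<Rightarrow> nat) \<times> nat \<times> (nat \<Rightarrow> nat)) set"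
  where "labelled_cycles n k =
    (SIGMA \<nu>:n_cycles n. {1..n} \<times> step_sequences n k (descents \<nu>))"

lemma finite_labelled_cycles: "finite (labelled_cycles n k)"
  unfolding labelled_cycles_def
  by (intro finite_SigmaI finite_n_cycles finite_cartesian_product finite_step_sequences) auto

lemma card_labelled_cycles:
  "card (labelled_cycles n k) = n * (\<Sum>\<nu>\<in>n_cycles n. card (step_sequences n k (descents \<nu>)))"
  unfolding labelled_cycles_def
  by (subst card_SigmaI) (auto simp: finite_n_cycles finite_step_sequences card_cartesian_product sum_distrib_left)

lemma rank_of_bij:
  fixes t :: "nat \<Rightarrow> nat"
  assumes "bij_betw t {..<n} {1..n}" "m < n"
  shows "t m = card {m' \<in> {..<n}. t m' \<le> t m}"
proof -
  have tm: "t m \<in> {1..n}" using assms by (auto dest: bij_betwE)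
  have "t ` {m' \<in> {..<n}. t m' \<le> t m} = {1..t m}"
  proof (intro equalityI subsetI)
    fix y assume "y \<in> {1..t m}"
    then have "y \<in> t ` {..<n}" using assms(1) tm by (auto simp: bij_betw_def)
    then show "y \<in> t ` {m' \<in> {..<n}. t m' \<le> t m}" using \<open>y \<in> {1..t m}\<close> by auto
  next
    fix y assume "y \<in> t ` {m' \<in> {..<n}. t m' \<le> t m}"
    then show "y \<in> {1..t m}" using assms(1) by (force dest: bij_betwE)
  qed
  moreover have "inj_on t {m' \<in> {..<n}. t m' \<le> t m}"
    using assms(1) by (auto simp: bij_betw_def intro: inj_on_subset)
  ultimately show ?thesis by (metis card_atLeastAtMost card_image diff_Suc_1)
qed

text \<open>
  The word of labels read along a cycle determines the order in which the cycle visits \<open>{1..n}\<close>.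
  If two cycles with the same word order the times \<open>m\<close> and \<open>m'\<close> oppositely, then the
  labels at these times agree, so the times \<open>m + 1\<close> and \<open>m' + 1\<close> are again ordered oppositely, and
  so on forever. But over a full period both times run through the same values \<open>{1..n}\<close>, so one
  cannot stay below the other.
\<close>
lemma same_word_same_order:
  fixes \<nu> \<nu>' :: "nat \<Rightarrow> nat"
  assumes \<nu>: "\<nu> \<in> n_cycles n" "s \<in> {1..n}" "a \<in> step_sequences n k (descents \<nu>)"
    and \<nu>': "\<nu>' \<in> n_cycles n" "s' \<in> {1..n}" "a' \<in> step_sequences n k' (descents \<nu>')"
    and word: "\<And>m. a ((\<nu> ^^ m) s) = a' ((\<nu>' ^^ m) s')"
    and m: "m < n" "m' < n" "(\<nu> ^^ m) s < (\<nu> ^^ m') s"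
  shows "(\<nu>' ^^ m) s' < (\<nu>' ^^ m') s'"
proof (rule ccontr)
  assume not: "\<not> (\<nu>' ^^ m) s' < (\<nu>' ^^ m') s'"
  have in_range: "(\<nu> ^^ j) s \<in> {1..n}" "(\<nu>' ^^ j) s' \<in> {1..n}" for j
    using cyclic_on_funpow_in[OF n_cyclesD(2)] \<nu> \<nu>' by auto
  have "m \<noteq> m'" using m(3) by auto
  then have "(\<nu>' ^^ m) s' \<noteq> (\<nu>' ^^ m') s'"
    using n_cycles_traversal(1)[OF \<nu>'(1,2)] m(1,2) by (auto simp: bij_betw_def inj_on_def)
  with not have start: "(\<nu>' ^^ m') s' < (\<nu>' ^^ m) s'" by simp
  have forever: "(\<nu> ^^ (j + m)) s < (\<nu> ^^ (j + m')) s \<and> (\<nu>' ^^ (j + m')) s' < (\<nu>' ^^ (j + m)) s'" for j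
  proof (induction j)
    case 0
    show ?case using m(3) start by simp
  next
    case (Suc j)
    let ?x = "(\<nu> ^^ (j + m)) s" and ?y = "(\<nu> ^^ (j + m')) s"
    let ?x' = "(\<nu>' ^^ (j + m)) s'" and ?y' = "(\<nu>' ^^ (j + m')) s'"
    have "a ?x \<le> a ?y" "a' ?y' \<le> a' ?x'"
      using step_sequences_mono[OF \<nu>(3), of ?x ?y] step_sequences_mono[OF \<nu>'(3), of ?y' ?x']
        Suc in_range by (auto simp: less_imp_le)
    then have "a ?x = a ?y" "a' ?y' = a' ?x'" using word[of "j + m"] word[of "j + m'"] by auto
    then have "\<nu> ?x < \<nu> ?y" "\<nu>' ?y' < \<nu>' ?x'"
      using step_sequences_descents_less[OF \<nu>(3) n_cycles_inj[OF \<nu>(1)], of ?x ?y]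
        step_sequences_descents_less[OF \<nu>'(3) n_cycles_inj[OF \<nu>'(1)], of ?y' ?x']
        Suc in_range by auto
    then show ?case by simp
  qed
  have total: "(\<Sum>j<n. (\<nu> ^^ (j + i)) s) = \<Sum>{1..n}" for i
    using sum.reindex_bij_betw[OF n_cycles_traversal(1)[OF \<nu>(1) in_range(1)[of i]], of "\<lambda>x. x"]
    by (simp add: funpow_add)
  have "(\<Sum>j<n. (\<nu> ^^ (j + m)) s) < (\<Sum>j<n. (\<nu> ^^ (j + m')) s)"
    using forever m(1) by (intro sum_strict_mono) auto
  then show False unfolding total by simp
qed

text \<open>
  The word of labels determines the triple: it fixes the order of the visits by
  \<open>same_word_same_order\<close>, hence each visited element as a rank among all of them, and the three components can be
  read off from the sequence of visits.
\<close>
lemma card_labelled_cycles_le: "card (labelled_cycles n k) \<le> k ^ n"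
proof -
  let ?word = "\<lambda>(\<nu> :: nat \<Rightarrow> nat, s :: nat, a :: nat \<Rightarrow> nat). map (\<lambda>m. a ((\<nu> ^^ m) s)) [0..<n]"
  let ?W = "{xs. set xs \<subseteq> {..<k} \<and> length xs = n}"
  have "inj_on ?word (labelled_cycles n k)"
  proof (rule inj_onI)
    fix p p' assume p: "p \<in> labelled_cycles n k" "p' \<in> labelled_cycles n k" "?word p = ?word p'"
    obtain \<nu> s a \<nu>' s' a' where pp': "p = (\<nu>, s, a)" "p' = (\<nu>', s', a')"
      by (cases p, cases p')
    then have w: "map (\<lambda>m. a ((\<nu> ^^ m) s)) [0..<n] = map (\<lambda>m. a' ((\<nu>' ^^ m) s')) [0..<n]"
      using p(3) by simp
    from p pp' have \<nu>: "\<nu> \<in> n_cycles n" "s \<in> {1..n}" "a \<in> step_sequences n k (descents \<nu>)"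
      and \<nu>': "\<nu>' \<in> n_cycles n" "s' \<in> {1..n}" "a' \<in> step_sequences n k (descents \<nu>')"
      by (auto simp: labelled_cycles_def)
    note t = n_cycles_traversal[OF \<nu>(1,2)] and t' = n_cycles_traversal[OF \<nu>'(1,2)]
    have n: "n > 0" using \<nu>(2) by simp
    have word: "a ((\<nu> ^^ m) s) = a' ((\<nu>' ^^ m) s')" for m
    proof -
      have "a ((\<nu> ^^ (m mod n)) s) = a' ((\<nu>' ^^ (m mod n)) s')"
        using w n by (simp add: map_eq_conv)
      then show ?thesis by (simp add: funpow_mod_eq[OF t(2)] funpow_mod_eq[OF t'(2)])
    qed
    have iff: "(\<nu> ^^ m') s \<le> (\<nu> ^^ m) s \<longleftrightarrow> (\<nu>' ^^ m') s' \<le> (\<nu>' ^^ m) s'" if "m < n" "m' < n" for m m'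
      using same_word_same_order[OF \<nu> \<nu>' word that] same_word_same_order[OF \<nu>' \<nu> word[symmetric] that]
      by (auto simp: not_less[symmetric])
    have "(\<nu> ^^ m) s = (\<nu>' ^^ m) s'" if "m < n" for m
    proof -
      have "{m' \<in> {..<n}. (\<nu> ^^ m') s \<le> (\<nu> ^^ m) s} = {m' \<in> {..<n}. (\<nu>' ^^ m') s' \<le> (\<nu>' ^^ m) s'}"
        using iff[OF that] by auto
      then show ?thesis
        by (metis (lifting) rank_of_bij[OF t(1) that] rank_of_bij[OF t'(1) that])
    qed
    then have eq: "(\<nu> ^^ m) s = (\<nu>' ^^ m) s'" for m
      using n by (metis funpow_mod_eq[OF t(2)] funpow_mod_eq[OF t'(2)] mod_less_divisor)
    have cover: "\<exists>m. i = (\<nu> ^^ m) s" if "i \<in> {1..n}" for i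
      using t(1) that by (auto simp: bij_betw_def)
    have "s = s'" using eq[of 0] by simp
    moreover have "\<nu> = \<nu>'"
    proof
      fix i show "\<nu> i = \<nu>' i"
      proof (cases "i \<in> {1..n}")
        case True
        then obtain m where "i = (\<nu> ^^ m) s" using cover by blast
        then show ?thesis using eq[of m] eq[of "Suc m"] by simp
      next
        case False
        then show ?thesis using n_cyclesD(1)[OF \<nu>(1)] n_cyclesD(1)[OF \<nu>'(1)]
          by (simp add: permutes_not_in)
      qed
    qed
    moreover have "a = a'"
    proof
      fix i show "a i = a' i"
      proof (cases "i \<in> {1..n}")
        case True
        then obtain m where "i = (\<nu> ^^ m) s" using cover by blast
        then show ?thesis using eq[of m] word[of m] by simp
      next
        case False
        then show ?thesis using \<nu>(3) \<nu>'(3) by (auto simp: step_sequences_def PiE_def extensional_def)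
      qed
    qed
    ultimately show "p = p'" using pp' by simp
  qed
  moreover have "?word ` labelled_cycles n k \<subseteq> ?W"
  proof (clarsimp simp: labelled_cycles_def)
    fix \<nu> s a m
    assume *: "\<nu> \<in> n_cycles n" "Suc 0 \<le> s" "s \<le> n" "a \<in> step_sequences n k (descents \<nu>)" "m < n"
    then have "(\<nu> ^^ m) s \<in> {1..n}" using cyclic_on_funpow_in[OF n_cyclesD(2)] by auto
    then show "a ((\<nu> ^^ m) s) < k" using *(4) by (auto simp: step_sequences_def)
  qed
  ultimately have "card (labelled_cycles n k) \<le> card ?W"
    by (intro card_inj_on_le) (auto simp: finite_lists_length_eq)
  then show ?thesis by (simp add: card_lists_length_eq)
qed

section \<open>Periodic orbits of multiplication on the circle\<close>

lemma rank_strict_mono: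
  fixes X :: "nat set"
  assumes "finite X" "y \<in> X" "z \<in> X" "y < z"
  shows "card {w \<in> X. w \<le> y} < card {w \<in> X. w \<le> z}"
proof (rule psubset_card_mono)
  have "z \<in> {w \<in> X. w \<le> z}" "z \<notin> {w \<in> X. w \<le> y}" using assms by auto
  moreover have "{w \<in> X. w \<le> y} \<subseteq> {w \<in> X. w \<le> z}" using assms by auto
  ultimately show "{w \<in> X. w \<le> y} \<subset> {w \<in> X. w \<le> z}" by blast
qed (use assms in simp)

lemma bij_betw_rank:
  fixes X :: "nat set"
  assumes "finite X"
  shows "bij_betw (\<lambda>y. card {w \<in> X. w \<le> y}) X {1..card X}"
proof -
  let ?r = "\<lambda>y. card {w \<in> X. w \<le> y}"
  have inj: "inj_on ?r X"
  proof (rule inj_onI)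
    fix x y assume "x \<in> X" "y \<in> X" "?r x = ?r y"
    then show "x = y"
      using rank_strict_mono[OF assms, of x y] rank_strict_mono[OF assms, of y x]
      by (cases x y rule: linorder_cases) auto
  qed
  have "?r ` X \<subseteq> {1..card X}"
  proof (intro image_subsetI)
    fix y assume "y \<in> X"
    then have "?r y > 0" using assms by (auto simp: card_gt_0_iff)
    moreover have "?r y \<le> card X" using assms by (intro card_mono) auto
    ultimately show "?r y \<in> {1..card X}" by simp
  qed
  then have "?r ` X = {1..card X}"
    by (intro card_subset_eq) (simp_all add: card_image[OF inj])
  then show ?thesis using inj by (simp add: bij_betw_def)
qed

text \<open>
  Numbering a finite orbit by size turns it into a cycle on \<open>{1..n}\<close>. If \<open>d\<close> behaves like a leading
  digit for \<open>T\<close>, it becomes a labelling of that cycle: where \<open>\<nu>\<close> descends, \<open>T\<close> reverses the order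
  of two neighbours, so their digits must differ.
\<close>
lemma labelled_cycle_of_orbit:
  fixes T d :: "nat \<Rightarrow> nat"
  assumes fin: "finite X" and card: "card X = n" and cyc: "cyclic_on T X" and x: "x \<in> X"
    and d: "\<And>y. y \<in> X \<Longrightarrow> d y < k"
    and mono: "\<And>y z. y \<in> X \<Longrightarrow> z \<in> X \<Longrightarrow> y < z \<Longrightarrow> d y \<le> d z"
    and mono': "\<And>y z. y \<in> X \<Longrightarrow> z \<in> X \<Longrightarrow> y < z \<Longrightarrow> d y = d z \<Longrightarrow> T y < T z"
  obtains \<nu> s a where "(\<nu>, s, a) \<in> labelled_cycles n k" "\<And>m. a ((\<nu> ^^ m) s) = d ((T ^^ m) x)"
proof -
  define r where "r y = card {w \<in> X. w \<le> y}" for y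
  have r: "bij_betw r X {1..n}"
    using bij_betw_rank[OF fin] unfolding r_def card .
  have r_less: "r y < r z \<longleftrightarrow> y < z" if "y \<in> X" "z \<in> X" for y z
    using rank_strict_mono[OF fin that] rank_strict_mono[OF fin that(2,1)]
    unfolding r_def by (cases y z rule: linorder_cases) auto
  define \<sigma> where "\<sigma> = inv_into X r"
  have \<sigma>: "bij_betw \<sigma> {1..n} X" unfolding \<sigma>_def by (rule bij_betw_inv_into[OF r])
  have \<sigma>_in: "\<sigma> i \<in> X" if "i \<in> {1..n}" for i using \<sigma> that by (auto dest: bij_betwE)
  have r\<sigma>: "r (\<sigma> i) = i" if "i \<in> {1..n}" for i
    unfolding \<sigma>_def by (rule bij_betw_inv_into_right[OF r that])
  have \<sigma>r: "\<sigma> (r y) = y" if "y \<in> X" for y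
    unfolding \<sigma>_def by (rule bij_betw_inv_into_left[OF r that])
  have r_in: "r y \<in> {1..n}" if "y \<in> X" for y using r that by (auto dest: bij_betwE)
  have T_in: "T y \<in> X" if "y \<in> X" for y by (rule cyclic_on_inI[OF cyc that])
  have T_bij: "bij_betw T X X"
  proof -
    have "X \<subseteq> T ` X"
    proof
      fix y assume y: "y \<in> X"
      then have "y \<in> orbit T y" using cyc by (auto simp: cyclic_on_alldef)
      then obtain m where "0 < m" "y = (T ^^ m) y" by (auto simp: orbit_altdef)
      then have "y = T ((T ^^ (m - 1)) y)" by (cases m) auto
      then show "y \<in> T ` X" using cyclic_on_funpow_in[OF cyc y] by blast
    qed
    then have "T ` X = X" using T_in by blast
    then show ?thesis using fin by (simp add: bij_betw_def finite_surj_inj)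
  qed
  define \<nu> where "\<nu> i = (if i \<in> {1..n} then r (T (\<sigma> i)) else i)" for i
  have \<nu>r: "\<nu> (r y) = r (T y)" if "y \<in> X" for y
    using that unfolding \<nu>_def by (simp only: r_in \<sigma>r if_True)
  have "bij_betw (r \<circ> (T \<circ> \<sigma>)) {1..n} {1..n}"
    by (rule bij_betw_trans[OF bij_betw_trans[OF \<sigma> T_bij] r])
  then have "bij_betw \<nu> {1..n} {1..n}"
    by (rule bij_betw_cong[THEN iffD1, rotated]) (simp add: \<nu>_def)
  then have perm: "\<nu> permutes {1..n}" by (rule bij_imp_permutes) (auto simp: \<nu>_def)
  have "cyclic_on \<nu> (r ` X)" by (rule cyclic_on_image[OF cyc]) (rule \<nu>r)
  then have \<nu>: "\<nu> \<in> n_cycles n"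
    using perm r by (simp add: n_cycles_def sym_group_def bij_betw_def)
  define a where "a = restrict (\<lambda>i. d (\<sigma> i)) {1..n}"
  have "a \<in> step_sequences n k (descents \<nu>)"
    unfolding step_sequences_def
  proof (intro CollectI conjI ballI impI)
    show "a \<in> {1..n} \<rightarrow>\<^sub>E {..<k}" using d \<sigma>_in by (auto simp: a_def)
    fix i assume "i \<in> {1..<n}"
    then have i: "i \<in> {1..n}" "Suc i \<in> {1..n}" by auto
    have less: "\<sigma> i < \<sigma> (Suc i)"
      using r_less[OF \<sigma>_in[OF i(1)] \<sigma>_in[OF i(2)]] r\<sigma>[OF i(1)] r\<sigma>[OF i(2)] by simp
    have a: "a i = d (\<sigma> i)" "a (Suc i) = d (\<sigma> (Suc i))" using i by (auto simp: a_def)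
    show le: "a i \<le> a (Suc i)" unfolding a by (rule mono[OF \<sigma>_in[OF i(1)] \<sigma>_in[OF i(2)] less])
    assume "i \<in> descents \<nu>"
    then have "r (T (\<sigma> (Suc i))) < r (T (\<sigma> i))" using i by (simp add: descents_def \<nu>_def)
    then have "T (\<sigma> (Suc i)) < T (\<sigma> i)"
      using r_less[OF T_in[OF \<sigma>_in[OF i(2)]] T_in[OF \<sigma>_in[OF i(1)]]] by simp
    then have "d (\<sigma> i) \<noteq> d (\<sigma> (Suc i))"
      using mono'[OF \<sigma>_in[OF i(1)] \<sigma>_in[OF i(2)] less] by linarith
    then show "a i < a (Suc i)" using le a by simp
  qed
  then have "(\<nu>, r x, a) \<in> labelled_cycles n k"
    using \<nu> r_in[OF x] by (simp add: labelled_cycles_def)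
  moreover have "a ((\<nu> ^^ m) (r x)) = d ((T ^^ m) x)" for m
  proof -
    have "(\<nu> ^^ m) (r x) = r ((T ^^ m) x)"
      by (induction m) (simp_all add: \<nu>r cyclic_on_funpow_in[OF cyc x])
    then show ?thesis
      using r_in[of "(T ^^ m) x"] \<sigma>r[of "(T ^^ m) x"] cyclic_on_funpow_in[OF cyc x, of m]
      by (simp add: a_def)
  qed
  ultimately show thesis by (rule that)
qed

text \<open>
  Multiplication by \<open>k\<close> on the fractions \<open>x / (k ^ n - 1)\<close> modulo 1, in terms of numerators. The
  quotient \<open>first_digit\<close> is the leading digit of the base-\<open>k\<close> expansion of the fraction.
\<close>
definition circle_map :: "nat \<Rightarrow> nat \<Rightarrow> nat \<Rightarrow> nat"
  where "circle_map n k x = k * x mod (k ^ n - 1)"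

definition first_digit :: "nat \<Rightarrow> nat \<Rightarrow> nat \<Rightarrow> nat"
  where "first_digit n k x = k * x div (k ^ n - 1)"

lemma circle_map_first_digit: "k * x = (k ^ n - 1) * first_digit n k x + circle_map n k x"
  by (simp add: circle_map_def first_digit_def)

lemma funpow_circle_map:
  assumes "x < k ^ n - 1"
  shows "(circle_map n k ^^ m) x = k ^ m * x mod (k ^ n - 1)"
proof (induction m)
  case (Suc m)
  then show ?case by (simp add: circle_map_def mod_mult_right_eq mult.assoc)
qed (use assms in simp)

lemma funpow_circle_map_period:
  assumes "x < k ^ n - 1"
  shows "(circle_map n k ^^ n) x = x"
proof -
  have "k ^ n * x = x + x * (k ^ n - 1)" using assms by (cases "k ^ n") auto
  then show ?thesis unfolding funpow_circle_map[OF assms] using assms by simp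
qed

text \<open>
  Points with the same digits are pulled apart by the factor \<open>k\<close> at every step, yet after \<open>n\<close>
  steps their distance is the original one.
\<close>
lemma digits_determine_point:
  assumes "x < k ^ n - 1" "y < k ^ n - 1"
    and "\<And>m. first_digit n k ((circle_map n k ^^ m) x) = first_digit n k ((circle_map n k ^^ m) y)"
  shows "x = y"
proof -
  have "int ((circle_map n k ^^ m) x) - int ((circle_map n k ^^ m) y) = int k ^ m * (int x - int y)" for m
  proof (induction m)
    case (Suc m)
    let ?x = "(circle_map n k ^^ m) x" and ?y = "(circle_map n k ^^ m) y"
    have "int k * int ?x - int k * int ?y = int (circle_map n k ?x) - int (circle_map n k ?y)"
      using circle_map_first_digit[of k ?x n] circle_map_first_digit[of k ?y n] assms(3)[of m]
      by (simp only: of_nat_mult[symmetric])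
    then have "int (circle_map n k ?x) - int (circle_map n k ?y) = int k * (int ?x - int ?y)"
      by (simp only: right_diff_distrib)
    then show ?case unfolding Suc by simp
  qed simp
  from this[of n] have "(int k ^ n - 1) * (int x - int y) = 0"
    using assms(1,2) by (simp add: funpow_circle_map_period algebra_simps)
  moreover have "int (k ^ n) - 1 \<noteq> 0" using assms(1) by linarith
  ultimately show ?thesis by (simp only: of_nat_power mult_eq_0_iff) simp
qed

definition period_points :: "nat \<Rightarrow> nat \<Rightarrow> nat set"
  where "period_points n k = {x. x < k ^ n - 1 \<and> inj_on (\<lambda>m. (circle_map n k ^^ m) x) {..<n}}"

lemma card_period_points_le: "card (period_points n k) \<le> card (labelled_cycles n k)" if "n \<ge> 1"
proof -
  have "\<exists>p. p \<in> labelled_cycles n k \<and> (\<forall>m. case p of (\<nu>, s, a) \<Rightarrow>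
      a ((\<nu> ^^ m) s) = first_digit n k ((circle_map n k ^^ m) x))" if x: "x \<in> period_points n k" for x
  proof -
    let ?T = "circle_map n k" and ?M = "k ^ n - 1"
    let ?O = "(\<lambda>m. (?T ^^ m) x) ` {..<n}"
    have xM: "x < ?M" and inj: "inj_on (\<lambda>m. (?T ^^ m) x) {..<n}"
      using x by (auto simp: period_points_def)
    have k: "k > 0" using xM \<open>n \<ge> 1\<close> by (cases k) (auto simp: power_0_left)
    note period = funpow_circle_map_period[OF xM]
    have O_eq: "?O = orbit ?T x"
      using orbit_altdef_bounded[OF period] \<open>n \<ge> 1\<close> by (auto simp: image_def)
    have xO: "x \<in> ?O" using \<open>n \<ge> 1\<close> by (intro image_eqI[of _ _ 0]) auto
    have lt: "y < ?M" if "y \<in> ?O" for y using that xM by (auto simp: funpow_circle_map)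
    obtain \<nu> s a where "(\<nu>, s, a) \<in> labelled_cycles n k"
      "\<And>m. a ((\<nu> ^^ m) s) = first_digit n k ((?T ^^ m) x)"
    proof (rule labelled_cycle_of_orbit[of ?O n ?T x "first_digit n k" k])
      show "card ?O = n" using card_image[OF inj] by simp
      show "cyclic_on ?T ?O" using O_eq xO unfolding cyclic_on_def by metis
      show "first_digit n k y < k" if "y \<in> ?O" for y
        unfolding first_digit_def using lt[OF that] k by (intro less_mult_imp_div_less) simp
      show "first_digit n k y \<le> first_digit n k z" if "y < z" for y z
        unfolding first_digit_def using that by (intro div_le_mono mult_le_mono2) simp
      show "?T y < ?T z" if "y \<in> ?O" "z \<in> ?O" "y < z" "first_digit n k y = first_digit n k z" for y z
      proof -
        have "k * y < k * z" using that(3) k by simp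
        then show ?thesis using circle_map_first_digit[of k y n] circle_map_first_digit[of k z n] that(4) by simp
      qed
    qed (use xO in auto)
    then show ?thesis by (intro exI[of _ "(\<nu>, s, a)"]) simp
  qed
  then obtain \<Psi> where \<Psi>: "\<And>x. x \<in> period_points n k \<Longrightarrow> \<Psi> x \<in> labelled_cycles n k \<and>
      (\<forall>m. case \<Psi> x of (\<nu>, s, a) \<Rightarrow> a ((\<nu> ^^ m) s) = first_digit n k ((circle_map n k ^^ m) x))"
    by metis
  \<comment> \<open>The digits of a point can be recovered from the triple, and they determine the point.\<close>
  have "inj_on \<Psi> (period_points n k)"
  proof (rule inj_onI)
    fix x y assume *: "x \<in> period_points n k" "y \<in> period_points n k" "\<Psi> x = \<Psi> y"
    obtain \<nu> s a where p: "\<Psi> x = (\<nu>, s, a)" by (cases "\<Psi> x")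
    have "first_digit n k ((circle_map n k ^^ m) x) = first_digit n k ((circle_map n k ^^ m) y)" for m
    proof -
      have "a ((\<nu> ^^ m) s) = first_digit n k ((circle_map n k ^^ m) x)"
        using \<Psi>[OF *(1)] p by simp
      moreover have "a ((\<nu> ^^ m) s) = first_digit n k ((circle_map n k ^^ m) y)"
        using \<Psi>[OF *(2)] p *(3) by simp
      ultimately show ?thesis by simp
    qed
    then show "x = y" using * by (intro digits_determine_point[of x k n y]) (auto simp: period_points_def)
  qed
  moreover have "\<Psi> ` period_points n k \<subseteq> labelled_cycles n k" using \<Psi> by blast
  ultimately show ?thesis by (rule card_inj_on_le[OF _ _ finite_labelled_cycles])
qed

text \<open>
  The least period divides \<open>n\<close>; if it is smaller than \<open>n\<close> it is at most half of it. This halving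
  makes the points without exact period \<open>n\<close> negligible.
\<close>
lemma proper_period:
  fixes f :: "'a \<Rightarrow> 'a" and x :: 'a and n :: nat
  assumes "(f ^^ n) x = x" "\<not> inj_on (\<lambda>m. (f ^^ m) x) {..<n}"
  obtains g where "0 < g" "g \<le> n div 2" "(f ^^ g) x = x"
proof -
  obtain i j where ij: "i < j" "j < n" "(f ^^ i) x = (f ^^ j) x"
  proof -
    obtain i j where *: "i < n" "j < n" "i \<noteq> j" "(f ^^ i) x = (f ^^ j) x"
      using assms(2) by (auto simp: inj_on_def)
    show thesis
    proof (cases "i < j")
      case True
      then show ?thesis using that * by blast
    next
      case False
      then show ?thesis using that[of j i] * by simp
    qed
  qed
  \<comment> \<open>From time \<open>j\<close> the orbit returns to its start after \<open>n - j\<close> steps; so it does from time \<open>i\<close>.\<close>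
  let ?e = "n - j + i"
  have "(f ^^ ?e) x = (f ^^ (n - j)) ((f ^^ i) x)" by (simp add: funpow_add)
  also have "\<dots> = (f ^^ (n - j)) ((f ^^ j) x)" by (simp add: ij)
  also have "\<dots> = (f ^^ (n - j + j)) x" by (simp only: funpow_add comp_apply)
  also have "\<dots> = x" using ij assms(1) by simp
  finally have e: "(f ^^ ?e) x = x" "0 < ?e" "?e < n" using ij by auto
  define g where "g = (LEAST g. 0 < g \<and> (f ^^ g) x = x)"
  have g: "0 < g \<and> (f ^^ g) x = x" unfolding g_def by (rule LeastI[of _ ?e]) (use e in simp)
  have "g \<le> ?e" unfolding g_def by (rule Least_le) (use e in simp)
  then have gn: "g < n" using e by simp
  have "(f ^^ (n mod g)) x = x" using funpow_mod_eq[where f = f and n = g and x = x and m = n] g assms(1) by simp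
  moreover have "n mod g < g" using g by simp
  ultimately have "n mod g = 0"
    using not_less_Least[of "n mod g" "\<lambda>g. 0 < g \<and> (f ^^ g) x = x"] unfolding g_def[symmetric] by auto
  then obtain q where q: "n = g * q" by auto
  then have "q \<noteq> 0" "q \<noteq> 1" using gn by auto
  then have "g * 2 \<le> g * q" by (intro mult_le_mono2) simp
  then have "g \<le> n div 2" using q by linarith
  then show thesis using that g by blast
qed

text \<open>
  A point of period \<open>g\<close> is determined by its first \<open>g\<close> digits, here collected in the quotient of
  \<open>k ^ g * x\<close> by \<open>k ^ n - 1\<close>.
\<close>
lemma card_points_of_period_le:
  assumes "k \<ge> 2" "g > 0"
  shows "card {x. x < k ^ n - 1 \<and> (circle_map n k ^^ g) x = x} \<le> k ^ g"
proof -
  let ?M = "k ^ n - 1" and ?F = "{x. x < k ^ n - 1 \<and> (circle_map n k ^^ g) x = x}"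
  \<comment> \<open>The number whose base-\<open>k\<close> digits are the first \<open>g\<close> digits of the point.\<close>
  let ?u = "\<lambda>x. k ^ g * x div ?M"
  have eq: "k ^ g * x = ?M * ?u x + x" if "x \<in> ?F" for x
  proof -
    have "k ^ g * x mod ?M = x" using that funpow_circle_map[of x k n g] by auto
    then show ?thesis by (metis mult_div_mod_eq)
  qed
  have "inj_on ?u ?F"
  proof (rule inj_onI)
    fix x y assume xy: "x \<in> ?F" "y \<in> ?F" "?u x = ?u y"
    have "k ^ g * x = ?M * ?u y + x" "k ^ g * y = ?M * ?u y + y"
      using eq[OF xy(1)] eq[OF xy(2)] xy(3) by simp_all
    then have "int (k ^ g * x) - int x = int (k ^ g * y) - int y" by linarith
    then have "(int k ^ g - 1) * (int x - int y) = 0" by (simp add: algebra_simps)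
    moreover have "int k ^ g \<noteq> 1" using assms by (simp flip: of_nat_power)
    ultimately show "x = y" by simp
  qed
  moreover have "?u ` ?F \<subseteq> {..<k ^ g}"
    using assms(1) by (auto intro!: less_mult_imp_div_less)
  ultimately have "card ?F \<le> card {..<k ^ g}" by (intro card_inj_on_le) auto
  then show ?thesis by simp
qed

lemma card_period_points_ge:
  assumes "k \<ge> 2"
  shows "k ^ n \<le> card (period_points n k) + 1 + n * k ^ (n div 2)"
proof -
  let ?F = "\<lambda>g. {x. x < k ^ n - 1 \<and> (circle_map n k ^^ g) x = x}"
  have "{..<k ^ n - 1} \<subseteq> period_points n k \<union> (\<Union>g\<in>{1..n div 2}. ?F g)"
  proof
    fix x assume x: "x \<in> {..<k ^ n - 1}"
    show "x \<in> period_points n k \<union> (\<Union>g\<in>{1..n div 2}. ?F g)"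
    proof (cases "inj_on (\<lambda>m. (circle_map n k ^^ m) x) {..<n}")
      case True
      then show ?thesis using x by (simp add: period_points_def)
    next
      case False
      obtain g where "0 < g" "g \<le> n div 2" "(circle_map n k ^^ g) x = x"
        using proper_period[OF funpow_circle_map_period False] x by auto
      then show ?thesis using x by auto
    qed
  qed
  then have "card {..<k ^ n - 1} \<le> card (period_points n k \<union> (\<Union>g\<in>{1..n div 2}. ?F g))"
    by (intro card_mono) (auto simp: period_points_def)
  also have "\<dots> \<le> card (period_points n k) + card (\<Union>g\<in>{1..n div 2}. ?F g)"
    by (rule card_Un_le)
  also have "card (\<Union>g\<in>{1..n div 2}. ?F g) \<le> (\<Sum>g\<in>{1..n div 2}. card (?F g))"
    by (rule card_UN_le) simp
  also have "\<dots> \<le> (\<Sum>g\<in>{1..n div 2}. k ^ (n div 2))"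
  proof (rule sum_mono)
    fix g assume g: "g \<in> {1..n div 2}"
    then have "card (?F g) \<le> k ^ g" by (intro card_points_of_period_le assms) simp
    also have "\<dots> \<le> k ^ (n div 2)" using g assms by (intro power_increasing) auto
    finally show "card (?F g) \<le> k ^ (n div 2)" .
  qed
  also have "\<dots> \<le> n * k ^ (n div 2)" by (simp add: mult_le_mono1)
  finally show ?thesis by simp
qed

section \<open>The number of labelled cycles in terms of the degree\<close>

lemma perm_deg_le: "perm_deg n \<nu> \<le> n"
proof -
  have "perm_deg n \<nu> \<le> card {1..n}" unfolding perm_deg_def by (rule card_mono) auto
  then show ?thesis by simp
qed

lemma perm_deg_eq_descents:
  assumes "n \<ge> 1"
  shows "perm_deg n \<nu> = card (descents \<nu> \<inter> {1..<n}) + (if \<nu> n > \<nu> 1 then 1 else 0)"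
proof -
  have "{i \<in> {1..n}. \<nu> i > \<nu> (i mod n + 1)}
      = (descents \<nu> \<inter> {1..<n}) \<union> (if \<nu> n > \<nu> 1 then {n} else {})"
    using assms by (auto simp: descents_def le_less split: if_splits)
  then show ?thesis unfolding perm_deg_def by (simp only:) (subst card_Un_disjoint, auto)
qed

lemma times_binomial_absorb: "Suc m \<le> N + 1 \<Longrightarrow> real (Suc m) * real (N choose Suc m) = (real N - real m) * real (N choose m)"
proof -
  assume "Suc m \<le> N + 1"
  then have "real (N - m) = real N - real m" by simp
  moreover have "Suc m * (N choose Suc m) = (N - m) * (N choose m)"
    by (metis binomial_absorb_comp binomial_absorption mult.commute)
  ultimately show ?thesis by (metis of_nat_mult)
qed

text \<open>
  With \<open>N = k - deg \<nu> + n - 1\<close>, a cycle with \<open>\<nu> n < \<nu> 1\<close> has \<open>N choose n\<close> labellings, and one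
  with \<open>\<nu> n > \<nu> 1\<close> has \<open>N choose (n - 1)\<close> more, by Pascal's rule. Replacing the indicator of the
  latter by its average \<open>(deg \<nu> - 1) / n\<close> and using
  \<open>n * (N choose n) = (k - deg \<nu>) * (N choose (n - 1))\<close>, the degree drops out of the factor
  \<open>(k - deg \<nu>) + (deg \<nu> - 1) = k - 1\<close>.
  The condition \<open>k \<ge> n\<close> keeps the subtraction \<open>k - deg \<nu>\<close> from being truncated.
\<close>
lemma card_labelled_cycles_perm_deg:
  assumes n: "n \<ge> 2" and k: "k \<ge> n"
  shows "real (card (labelled_cycles n k))
       = (real k - 1) * (\<Sum>\<nu>\<in>n_cycles n. real ((k - perm_deg n \<nu> + (n - 1)) choose (n - 1)))"
proof -
  let ?N = "\<lambda>d. k - d + (n - 1)"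
  have "real n * real (card (step_sequences n k (descents \<nu>)))
      = real n * real (?N (perm_deg n \<nu>) choose n)
        + real n * (if \<nu> n > \<nu> 1 then real (?N (perm_deg n \<nu>) choose (n - 1)) else 0)" for \<nu>
  proof (cases "\<nu> n > \<nu> 1")
    case True
    let ?d = "perm_deg n \<nu>"
    have d: "?d = Suc (card (descents \<nu> \<inter> {1..<n}))" using perm_deg_eq_descents[of n \<nu>] n True by simp
    then have "k + n - 1 - card (descents \<nu> \<inter> {1..<n}) = Suc (?N ?d)"
      using perm_deg_le[of n \<nu>] k n by simp
    then have "card (step_sequences n k (descents \<nu>)) = Suc (?N ?d) choose Suc (n - 1)"
      using card_step_sequences[of n k "descents \<nu>"] n by simp
    also have "\<dots> = (?N ?d choose n) + (?N ?d choose (n - 1))"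
      using n by (subst binomial_Suc_Suc) simp
    finally show ?thesis using True by (simp add: distrib_left)
  next
    case False
    let ?d = "perm_deg n \<nu>"
    have d: "?d = card (descents \<nu> \<inter> {1..<n})" using perm_deg_eq_descents[of n \<nu>] n False by simp
    then have "k + n - 1 - card (descents \<nu> \<inter> {1..<n}) = ?N ?d"
      using perm_deg_le[of n \<nu>] k n by simp
    then show ?thesis
      using card_step_sequences[of n k "descents \<nu>"] n False by simp
  qed
  then have "real (card (labelled_cycles n k))
      = (\<Sum>\<nu>\<in>n_cycles n. real n * real (?N (perm_deg n \<nu>) choose n))
        + real n * (\<Sum>\<nu>\<in>n_cycles n. if \<nu> n > \<nu> 1 then real (?N (perm_deg n \<nu>) choose (n - 1)) else 0)"
    by (simp add: card_labelled_cycles sum_distrib_left sum.distrib)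
  also have "\<dots> = (\<Sum>\<nu>\<in>n_cycles n. real n * real (?N (perm_deg n \<nu>) choose n)
        + (real (perm_deg n \<nu>) - 1) * real (?N (perm_deg n \<nu>) choose (n - 1)))"
    using sum_last_descent[OF n, of "\<lambda>d. real (?N d choose (n - 1))"] by (simp add: sum.distrib)
  also have "\<dots> = (\<Sum>\<nu>\<in>n_cycles n. (real k - 1) * real (?N (perm_deg n \<nu>) choose (n - 1)))"
  proof (intro sum.cong refl)
    fix \<nu>
    have "real n * real (?N (perm_deg n \<nu>) choose n)
        = (real (k - perm_deg n \<nu>)) * real (?N (perm_deg n \<nu>) choose (n - 1))"
      using times_binomial_absorb[of "n - 1" "?N (perm_deg n \<nu>)"] n by simp
    also have "real (k - perm_deg n \<nu>) = real k - real (perm_deg n \<nu>)"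
      using perm_deg_le[of n \<nu>] k by simp
    finally show "real n * real (?N (perm_deg n \<nu>) choose n)
        + (real (perm_deg n \<nu>) - 1) * real (?N (perm_deg n \<nu>) choose (n - 1))
      = (real k - 1) * real (?N (perm_deg n \<nu>) choose (n - 1))"
      by (simp add: algebra_simps)
  qed
  finally show ?thesis by (simp add: sum_distrib_left)
qed

section \<open>The generating polynomial\<close>

lemma degree_le_if_bounded_growth:
  fixes Q :: "real poly"
  assumes "\<And>k. k \<ge> N \<Longrightarrow> \<bar>poly Q (real k)\<bar> \<le> C * real k ^ m"
  shows "degree Q \<le> m"
proof (rule ccontr)
  assume "\<not> degree Q \<le> m"
  then have deg: "Suc m \<le> degree Q" by simp
  have "(\<lambda>k. poly Q (real k) / real k ^ degree Q) \<longlonglongrightarrow> lead_coeff Q"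
    by (rule filterlim_compose[OF poly_divide_tendsto_aux])
       (rule filterlim_compose[OF filterlim_real_at_infinity_sequentially filterlim_ident])
  moreover have "(\<lambda>k. poly Q (real k) / real k ^ degree Q) \<longlonglongrightarrow> 0"
  proof (rule tendsto_0_le[where K = 1])
    have "norm (poly Q (real k) / real k ^ degree Q) \<le> \<bar>C\<bar> / real k" if k: "k \<ge> max N 1" for k
    proof -
      have pos: "real k > 0" using k by simp
      have "\<bar>poly Q (real k)\<bar> * real k \<le> (\<bar>C\<bar> * real k ^ m) * real k"
        using assms[of k] k pos by (intro mult_right_mono order_trans[OF assms]) (auto intro!: mult_right_mono)
      also have "\<dots> = \<bar>C\<bar> * real k ^ Suc m" by simp
      also have "\<dots> \<le> \<bar>C\<bar> * real k ^ degree Q"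
        using k deg by (intro mult_left_mono power_increasing) auto
      finally show ?thesis using pos by (simp add: field_simps)
    qed
    then show "\<forall>\<^sub>F k in sequentially. norm (poly Q (real k) / real k ^ degree Q) \<le> norm (\<bar>C\<bar> / real k) * 1"
      by (intro eventually_sequentiallyI[of "max N 1"]) simp
    show "(\<lambda>k. \<bar>C\<bar> / real k) \<longlonglongrightarrow> 0" by (rule lim_const_over_n)
  qed
  ultimately have "lead_coeff Q = 0" by (rule LIMSEQ_unique)
  then show False using deg by simp
qed

text \<open>
  Vieta's formulas for the three leading coefficients. The second elementary symmetric function is
  expressed through power sums, which are easily evaluated for \<open>u t = t - deg \<nu>\<close>.
\<close>
lemma coeffs_prod_linear:
  fixes u :: "nat \<Rightarrow> real"
  defines "p m \<equiv> (\<Prod>t\<in>{1..m}. [:u t, 1:])"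
  shows "degree (p m) = m" "coeff (p m) m = 1"
    "coeff (p (Suc m)) m = (\<Sum>t\<in>{1..Suc m}. u t)"
    "2 * coeff (p (Suc (Suc m))) m = (\<Sum>t\<in>{1..Suc (Suc m)}. u t)\<^sup>2 - (\<Sum>t\<in>{1..Suc (Suc m)}. (u t)\<^sup>2)"
proof -
  have p_Suc: "p (Suc m) = [:u (Suc m), 1:] * p m" for m
    by (simp add: p_def mult.commute)
  have coeff0: "coeff (p (Suc m)) 0 = u (Suc m) * coeff (p m) 0" for m
    by (simp add: p_Suc)
  have coeffS: "coeff (p (Suc m)) (Suc i) = u (Suc m) * coeff (p m) (Suc i) + coeff (p m) i" for m i
    by (simp add: p_Suc)
  have p0: "p 0 = 1" by (simp add: p_def)
  show deg: "degree (p m) = m" for m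
  proof (induction m)
    case (Suc m)
    have "p m \<noteq> 0" by (simp add: p_def)
    then have "degree (p (Suc m)) = degree [:u (Suc m), 1:] + degree (p m)"
      unfolding p_Suc by (intro degree_mult_eq) auto
    then show ?case using Suc.IH by simp
  qed (simp add: p0)
  show c0: "coeff (p m) m = 1" for m
  proof (induction m)
    case (Suc m)
    then show ?case by (simp add: coeffS coeff_eq_0 deg)
  qed (simp add: p0)
  show c1: "coeff (p (Suc m)) m = (\<Sum>t\<in>{1..Suc m}. u t)" for m
  proof (induction m)
    case 0
    show ?case by (simp add: coeff0 p0)
  next
    case (Suc m)
    then show ?case by (simp add: coeffS[of "Suc m"] c0)
  qed
  show "2 * coeff (p (Suc (Suc m))) m = (\<Sum>t\<in>{1..Suc (Suc m)}. u t)\<^sup>2 - (\<Sum>t\<in>{1..Suc (Suc m)}. (u t)\<^sup>2)"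
  proof (induction m)
    case 0
    show ?case by (simp add: coeff0 p0 power2_eq_square algebra_simps)
  next
    case (Suc m)
    let ?v = "u (Suc (Suc (Suc m)))" and ?S = "\<Sum>t\<in>{1..Suc (Suc m)}. u t"
    have "2 * coeff (p (Suc (Suc (Suc m)))) (Suc m) = 2 * ?v * ?S + 2 * coeff (p (Suc (Suc m))) m"
      by (simp only: coeffS[of "Suc (Suc m)"] c1) simp
    also have "\<dots> = (?S + ?v)\<^sup>2 - ((\<Sum>t\<in>{1..Suc (Suc m)}. (u t)\<^sup>2) + ?v\<^sup>2)"
      unfolding Suc.IH by (simp add: power2_eq_square algebra_simps)
    finally show ?case by simp
  qed
qed

lemma fact_times_binomial: "fact m * real ((j + m) choose m) = (\<Prod>t\<in>{1..m}. real (j + t))"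
proof -
  have "fact j * (fact m * real ((j + m) choose m)) = fact (j + m)"
  proof -
    have "fact j * (fact m * ((j + m) choose m)) = (fact (j + m) :: nat)"
      using binomial_fact_lemma[of m "j + m"] by (simp add: ac_simps)
    then show ?thesis by (metis of_nat_fact of_nat_mult)
  qed
  also have "fact (j + m) = (fact j :: real) * (\<Prod>t\<in>{1..m}. real (j + t))"
    by (induction m) (simp_all add: algebra_simps)
  finally show ?thesis by simp
qed

text \<open>
  At a large natural number \<open>k\<close> the factors multiply to
  \<open>(n - 1)! * ((n - 1 + k - deg \<nu>) choose (n - 1))\<close>.
\<close>
definition deg_poly :: "nat \<Rightarrow> real poly"
  where "deg_poly n = (\<Sum>\<nu>\<in>n_cycles n. \<Prod>t\<in>{1..n - 1}. [:real t - real (perm_deg n \<nu>), 1:])"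

lemma coeff_linear_mult:
  "coeff ([:-1, 1:] * P) (Suc i) = coeff P i - coeff (P :: real poly) (Suc i)"
  by simp

text \<open>
  For natural \<open>k \<ge> n\<close> the left polynomial takes the value \<open>(n - 1)!\<close> times the number of labelled
  cycles, which lies within \<open>1 + n * k ^ (n div 2)\<close> of \<open>k ^ n\<close>. The polynomial minus
  \<open>(n - 1)! * X ^ n\<close> therefore grows no faster than \<open>k ^ (n div 2)\<close>, so its degree is at most
  \<open>n div 2\<close>.
\<close>
lemma coeff_deg_poly_times_linear:
  assumes "n \<ge> 2" "n div 2 < i"
  shows "coeff ([:-1, 1:] * deg_poly n) i = (if i = n then fact (n - 1) else 0)"
proof -
  define Q where "Q = [:-1, 1:] * deg_poly n - monom (fact (n - 1)) n"
  have "\<bar>poly Q (real k)\<bar> \<le> fact (n - 1) * (real n + 1) * real k ^ (n div 2)" if k: "k \<ge> n" for k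
  proof -
    have deg_le: "perm_deg n \<nu> \<le> k" for \<nu>
      using perm_deg_le[of n \<nu>] k by simp
    have "poly (deg_poly n) (real k) = (\<Sum>\<nu>\<in>n_cycles n. \<Prod>t\<in>{1..n - 1}. real (k - perm_deg n \<nu> + t))"
      unfolding deg_poly_def poly_sum poly_prod
      using deg_le by (intro sum.cong prod.cong refl) (simp add: of_nat_diff del: add_diff_assoc2)
    then have "poly (deg_poly n) (real k)
        = fact (n - 1) * (\<Sum>\<nu>\<in>n_cycles n. real ((k - perm_deg n \<nu> + (n - 1)) choose (n - 1)))"
      unfolding sum_distrib_left fact_times_binomial .
    then have "poly Q (real k) = fact (n - 1) * (real (card (labelled_cycles n k)) - real k ^ n)"
      unfolding card_labelled_cycles_perm_deg[OF assms(1) k] Q_def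
      by (simp add: poly_monom algebra_simps)
    then have Q: "\<bar>poly Q (real k)\<bar> = fact (n - 1) * \<bar>real (card (labelled_cycles n k)) - real k ^ n\<bar>"
      by (simp add: abs_mult)
    have "card (labelled_cycles n k) \<le> k ^ n" by (rule card_labelled_cycles_le)
    then have le: "real (card (labelled_cycles n k)) \<le> real k ^ n"
      by (metis of_nat_le_iff of_nat_power)
    have "k ^ n \<le> card (labelled_cycles n k) + 1 + n * k ^ (n div 2)"
      using card_period_points_ge[of k n] card_period_points_le[of n k] assms(1) k by simp
    then have "real (k ^ n) \<le> real (card (labelled_cycles n k) + 1 + n * k ^ (n div 2))"
      by (rule of_nat_mono)
    moreover have "1 \<le> real k ^ (n div 2)" using k assms(1) by (intro one_le_power) simp
    ultimately have "\<bar>real (card (labelled_cycles n k)) - real k ^ n\<bar> \<le> (real n + 1) * real k ^ (n div 2)"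
      using le by (simp add: algebra_simps)
    then show ?thesis unfolding Q mult.assoc by (intro mult_left_mono) auto
  qed
  then have "degree Q \<le> n div 2" by (rule degree_le_if_bounded_growth)
  then have "coeff Q i = 0" using assms(2) by (intro coeff_eq_0) simp
  then show ?thesis by (auto simp: Q_def)
qed

section \<open>Moments of the degree\<close>

lemma sum_shifted_naturals:
  fixes d :: real
  shows "(\<Sum>t\<in>{1..m}. real t - d) = real m * (real m + 1) / 2 - real m * d"
  by (induction m) (simp_all add: field_simps)

lemma sum_shifted_squares:
  fixes d :: real
  shows "(\<Sum>t\<in>{1..m}. (real t - d)\<^sup>2)
       = real m * (real m + 1) * (2 * real m + 1) / 6 - real m * (real m + 1) * d + real m * d\<^sup>2"
  by (induction m) (simp_all add: field_simps power2_eq_square)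

lemma coeff_deg_poly:
  "coeff (deg_poly (Suc m)) i
     = (\<Sum>\<nu>\<in>n_cycles (Suc m). coeff (\<Prod>t\<in>{1..m}. [:real t - real (perm_deg (Suc m) \<nu>), 1:]) i)"
  by (simp add: deg_poly_def coeff_sum)

lemma coeff_deg_poly_top:
  "coeff (deg_poly (Suc m)) m = real (card (n_cycles (Suc m)))"
  unfolding coeff_deg_poly coeffs_prod_linear(2) by simp

text \<open>
  The comparison of leading coefficients also yields the number of cycles.
\<close>
lemma card_n_cycles: "card (n_cycles n) = fact (n - 1)" if "n \<ge> 2"
proof -
  obtain m where m: "n = Suc m" using \<open>n \<ge> 2\<close> by (cases n) auto
  have "coeff (deg_poly n) (Suc m) = 0"
    unfolding m coeff_deg_poly
    by (intro sum.neutral ballI coeff_eq_0) (simp only: coeffs_prod_linear(1) lessI)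
  moreover have "coeff (deg_poly n) m = real (card (n_cycles n))"
    unfolding m by (rule coeff_deg_poly_top)
  moreover have "coeff (deg_poly n) m - coeff (deg_poly n) (Suc m) = fact (n - 1)"
    using coeff_deg_poly_times_linear[OF \<open>n \<ge> 2\<close>, of n] \<open>n \<ge> 2\<close>
    unfolding m coeff_linear_mult by simp
  ultimately have "real (card (n_cycles n)) = real (fact (n - 1))" by simp
  then show ?thesis by (rule of_nat_eq_iff[THEN iffD1])
qed

text \<open>
  Comparing coefficients of \<open>k ^ (n - 1)\<close>: the two leading coefficients of \<open>deg_poly n\<close> agree.
\<close>
lemma sum_perm_deg:
  assumes "n \<ge> 3"
  shows "(real n - 1) * (\<Sum>\<nu>\<in>n_cycles n. real (perm_deg n \<nu>))
       = fact (n - 1) * (real n * (real n - 1) / 2 - 1)"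
proof -
  obtain m where m: "n = Suc (Suc m)" using that[of "n - 2"] assms by simp
  have "coeff (deg_poly n) m
      = (\<Sum>\<nu>\<in>n_cycles n. \<Sum>t\<in>{1..Suc m}. real t - real (perm_deg n \<nu>))"
    unfolding m coeff_deg_poly coeffs_prod_linear(3) ..
  also have "\<dots> = real (card (n_cycles n)) * (real n * (real n - 1) / 2)
      - (real n - 1) * (\<Sum>\<nu>\<in>n_cycles n. real (perm_deg n \<nu>))"
    unfolding sum_shifted_naturals
    unfolding sum_subtractf sum_distrib_left by (simp add: m algebra_simps)
  finally have c: "coeff (deg_poly n) m = fact (n - 1) * (real n * (real n - 1) / 2)
      - (real n - 1) * (\<Sum>\<nu>\<in>n_cycles n. real (perm_deg n \<nu>))"
    using card_n_cycles[of n] assms by simp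
  have "coeff (deg_poly n) (Suc m) = fact (n - 1)"
    using coeff_deg_poly_top[of "Suc m"] card_n_cycles[of n] assms by (simp only: m[symmetric]) simp
  moreover have "coeff (deg_poly n) m = coeff (deg_poly n) (Suc m)"
    using coeff_deg_poly_times_linear[of n "Suc m"] assms
    unfolding m coeff_linear_mult by simp
  ultimately have "fact (n - 1) = fact (n - 1) * (real n * (real n - 1) / 2)
      - (real n - 1) * (\<Sum>\<nu>\<in>n_cycles n. real (perm_deg n \<nu>))"
    using c by simp
  then show ?thesis by (simp add: right_diff_distrib)
qed

text \<open>
  Comparing also coefficients of \<open>k ^ (n - 2)\<close>: the third coefficient of \<open>deg_poly n\<close>, a second
  elementary symmetric function, equals the first two.
\<close>
lemma sum_perm_deg_squares:
  assumes "n \<ge> 5"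
  defines "m \<equiv> real n - 1"
  shows "m * (m - 1) * (\<Sum>\<nu>\<in>n_cycles n. (real (perm_deg n \<nu>))\<^sup>2)
       = m * (m + 1) * (m - 1) * (\<Sum>\<nu>\<in>n_cycles n. real (perm_deg n \<nu>))
         + fact (n - 1) * (2 - m\<^sup>2 * (m + 1)\<^sup>2 / 4 + m * (m + 1) * (2 * m + 1) / 6)"
proof -
  obtain l where l: "n = Suc (Suc (Suc l))" using that[of "n - 3"] assms(1) by simp
  have m: "real (Suc (Suc l)) = m" by (simp add: m_def l)
  let ?d = "\<lambda>\<nu>. real (perm_deg n \<nu>)"
  have "2 * coeff (deg_poly n) l
      = (\<Sum>\<nu>\<in>n_cycles n. (\<Sum>t\<in>{1..Suc (Suc l)}. real t - ?d \<nu>)\<^sup>2 - (\<Sum>t\<in>{1..Suc (Suc l)}. (real t - ?d \<nu>)\<^sup>2))"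
    unfolding l coeff_deg_poly sum_distrib_left coeffs_prod_linear(4) ..
  also have "\<dots> = (\<Sum>\<nu>\<in>n_cycles n. (m\<^sup>2 * (m + 1)\<^sup>2 / 4 - m * (m + 1) * (2 * m + 1) / 6)
      - m * (m + 1) * (m - 1) * ?d \<nu> + m * (m - 1) * (?d \<nu>)\<^sup>2)"
    unfolding sum_shifted_naturals sum_shifted_squares m
    by (intro sum.cong refl) (simp add: field_simps power2_eq_square)
  also have "\<dots> = fact (n - 1) * (m\<^sup>2 * (m + 1)\<^sup>2 / 4 - m * (m + 1) * (2 * m + 1) / 6)
      - m * (m + 1) * (m - 1) * (\<Sum>\<nu>\<in>n_cycles n. ?d \<nu>) + m * (m - 1) * (\<Sum>\<nu>\<in>n_cycles n. (?d \<nu>)\<^sup>2)"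
    using card_n_cycles[of n] assms(1) by (simp add: sum.distrib sum_subtractf sum_distrib_left)
  finally have c: "2 * coeff (deg_poly n) l = \<dots>" .
  have top: "coeff ([:-1, 1:] * deg_poly n) i = (if i = n then fact (n - 1) else 0)"
    if "n div 2 < i" for i
    using coeff_deg_poly_times_linear[OF _ that] assms(1) by simp
  have "coeff (deg_poly n) (Suc (Suc l)) = fact (n - 1)"
    using coeff_deg_poly_top[of "Suc (Suc l)"] card_n_cycles[of n] assms(1) by (simp only: l[symmetric]) simp
  moreover have "coeff (deg_poly n) (Suc l) = coeff (deg_poly n) (Suc (Suc l))"
    using top[of "Suc (Suc l)"] assms(1) unfolding coeff_linear_mult by (simp add: l)
  moreover have "coeff (deg_poly n) l = coeff (deg_poly n) (Suc l)"
    using top[of "Suc l"] assms(1) unfolding coeff_linear_mult by (simp add: l)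
  ultimately have "2 * fact (n - 1) = fact (n - 1) * (m\<^sup>2 * (m + 1)\<^sup>2 / 4 - m * (m + 1) * (2 * m + 1) / 6)
      - m * (m + 1) * (m - 1) * (\<Sum>\<nu>\<in>n_cycles n. ?d \<nu>) + m * (m - 1) * (\<Sum>\<nu>\<in>n_cycles n. (?d \<nu>)\<^sup>2)"
    using c by simp
  then show ?thesis by (simp add: algebra_simps)
qed

lemma mean_deg_eq:
  assumes "n \<ge> 3"
  shows "mean_deg n = real n / 2 - 1 / (real n - 1)"
proof -
  have "(real n - 1) * mean_deg n = real n * (real n - 1) / 2 - 1"
    using sum_perm_deg[OF assms] by (simp add: mean_deg_def field_simps)
  then show ?thesis using assms by (simp add: field_simps)
qed

lemma var_deg_eq:
  assumes "n \<ge> 5"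
  shows "var_deg n = real n / 12 + real n / ((real n - 1)^2 * (real n - 2))"
proof -
  define m where "m = real n - 1"
  define \<mu> where "\<mu> = mean_deg n"
  define q where "q = 1 / fact (n - 1) * (\<Sum>\<nu>\<in>n_cycles n. (real (perm_deg n \<nu>))\<^sup>2)"
  let ?d = "\<lambda>\<nu>. real (perm_deg n \<nu>)"
  have m: "m \<ge> 4" using assms by (simp add: m_def)
  have S1: "(\<Sum>\<nu>\<in>n_cycles n. ?d \<nu>) = fact (n - 1) * \<mu>" by (simp add: \<mu>_def mean_deg_def)
  have S2: "(\<Sum>\<nu>\<in>n_cycles n. (?d \<nu>)\<^sup>2) = fact (n - 1) * q" by (simp add: q_def)
  have \<mu>: "\<mu> = (m + 1) / 2 - 1 / m"
    using mean_deg_eq[of n] assms by (simp add: \<mu>_def m_def)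
  have "fact (n - 1) * (m * (m - 1) * q) = fact (n - 1) *
      (m * (m + 1) * (m - 1) * \<mu> + (2 - m\<^sup>2 * (m + 1)\<^sup>2 / 4 + m * (m + 1) * (2 * m + 1) / 6))"
    using sum_perm_deg_squares[OF assms] unfolding S1 S2 m_def[symmetric] by (simp add: algebra_simps)
  then have "m * (m - 1) * q
      = m * (m + 1) * (m - 1) * \<mu> + (2 - m\<^sup>2 * (m + 1)\<^sup>2 / 4 + m * (m + 1) * (2 * m + 1) / 6)"
    by simp
  then have q: "q = (m + 1) * \<mu> + (2 - m\<^sup>2 * (m + 1)\<^sup>2 / 4 + m * (m + 1) * (2 * m + 1) / 6) / (m * (m - 1))"
    using m by (simp add: field_simps)
  have "(\<Sum>\<nu>\<in>n_cycles n. (?d \<nu> - \<mu>)\<^sup>2)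
      = (\<Sum>\<nu>\<in>n_cycles n. (?d \<nu>)\<^sup>2) - 2 * \<mu> * (\<Sum>\<nu>\<in>n_cycles n. ?d \<nu>) + fact (n - 1) * \<mu>\<^sup>2"
    using card_n_cycles[of n] assms
    by (simp add: power2_diff sum.distrib sum_subtractf sum_distrib_left algebra_simps)
  then have "(\<Sum>\<nu>\<in>n_cycles n. (?d \<nu> - \<mu>)\<^sup>2) = fact (n - 1) * (q - \<mu>\<^sup>2)"
    unfolding S1 S2 by (simp add: algebra_simps power2_eq_square)
  then have "var_deg n = q - \<mu>\<^sup>2" by (simp add: var_deg_def \<mu>_def)
  also have "\<dots> = (m + 1) / 12 + (m + 1) / (m\<^sup>2 * (m - 1))"
  proof -
    have ne: "m \<noteq> 0" "m - 1 \<noteq> 0" using m by auto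
    show ?thesis unfolding q \<mu> using ne
      by (simp add: divide_simps) algebra
  qed
  finally show ?thesis by (simp add: m_def)
qed

theorem theorem1p2:
  fixes n :: nat
  shows "(n \<ge> 3 \<longrightarrow> mean_deg n = real n / 2 - 1 / (real n - 1)) \<and>
         (n \<ge> 5 \<longrightarrow> var_deg n = real n / 12 + real n / ((real n - 1)^2 * (real n - 2)))"
  using mean_deg_eq var_deg_eq by blast

end
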